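(* Let $G:[0,\infty)\to[0,\infty)$ be increasing and continuous with $G(0)=0$. Let $G$ be uniformly continuous on bounded sets with modulus $\iota:(0,\infty)\times\mathbb N\to\mathbb N$, i.e. for all $b>0$, $k\in\mathbb N$ and $x,y\in[0,b]$: $|x-y|\le \frac1{\iota_b(k)+1}$ implies $|G(x)-G(y)|\le\frac1{k+1}$. Let $G$ be inverse continuous at $0$ with modulus $\nu:\mathbb N\to\mathbb N$, i.e. for all $k\in\mathbb N$ and $x\ge0$: $G(x)\le\frac1{\nu(k)+1}$ implies $x\le\frac1{k+1}$. Let $\gamma:\mathbb N\to\mathbb N$ be a modulus of total boundedness for $X_0$ and let $D$ be a bound for $X_0$ relative to $o$, i.e. $d(z,o)\le D$ for all $z\in X_0$. Let $(x_n)$ be a sequence of $X$-valued random variables adapted to the filtration $\mathcal F=(\mathcal F_n)$, and let $(\eta_n),(\chi_n)\in\ell^1_+(\mathcal F)$. Assume $f,h:(0,\infty)\to\mathbb N$ (with $h\ge1$) satisfy, for all $\lambda>0$, $$\mathbb P\Big(\sum_{i=0}^\infty\eta_i\ge f(\lambda)\Big)<\lambda,\qquad \mathbb P\Big(\prod_{i=0}^\infty(1+\chi_i)\ge h(\lambda)\Big)<\lambda .$$ Assume $\zeta:(0,\infty)\times\mathbb N^2\to\mathbb N$ satisfies: for all $\lambda>0$, $r,n\in\mathbb N$, $z\in AF_{\zeta(\lambda,r,n)}$ and $m\le n$, $$\mathbb P\Big(\mathbb E[G(d(x_{m+1},z))\mid\mathcal F_m]>(1+\chi_m)G(d(x_m,z))+\eta_m+\tfrac1{r+1}\Big)<\lambda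 .$$ Assume $\Phi:(0,\infty)\times\mathbb N^2\to\mathbb N$ satisfies: for all $\lambda>0$, $k,N\in\mathbb N$, $$\mathbb P\big(\forall n\in[N;\Phi(\lambda,k,N)]\ (x_n\notin AF_k)\big)<\lambda .$$ Assume $b:(0,\infty)\to\mathbb N$, $\lambda\mapsto b_\lambda$, satisfies $\mathbb P(\exists n\in\mathbb N\ (d(x_n,o)>b_\lambda))<\lambda$ for all $\lambda>0$. Let $b_0>\mathbb E[G(d(x_0,o)+D)]$, and for each $n$ let $\mu_n$ be a modulus of absolute continuity for $G(d(x_n,z))$, the same for all $z\in X_0$. Then $(x_n)$ is almost surely Cauchy and, for all $\lambda>0$, $k\in\mathbb N$ and $g:\mathbb N\to\mathbb N$, $$\mathbb P\Big(\forall n\le\Delta(\lambda,k,g)\ \exists i,j\in[n;n+g(n)]\ \big(d(x_i,x_j)>\tfrac1{k+1}\big)\Big)<\lambda ,$$ where $$\Delta(\lambda,k,g):=\max\{\Delta_i(\lambda,k,g)\mid i\in[0;\gamma(\iota_{2b_{\lambda/3}}(2\nu(2k+1)+1))]\},$$ $$\Delta_i(\lambda,k,g):=\max\{\Phi'(\lambda/3,k_i^\lambda,m)\mid m\le\Psi(\widehat\lambda_k,k_i^\lambda,h^{\lambda/3}_{k_i^\lambda},p_k^\lambda)\},$$ $$h^{\mu}_l(m):=\max\{m'+g(m')\mid m'\in[m;\Phi'(\mu,l,m)]\}-m,$$ $$k_0^\lambda:=\max\{6\nu(2k+1)+5,k\},\qquad k_{j+1}^\lambda:=\max\{\tilde Z(\widehat\lambda_k,k_i^\lambda,h^{\lambda/3}_{k_i^\lambda},p_k^\lambda),\,k_i^\lambda\mid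 i\le j\},$$ $$p_k^\lambda:=\gamma\big(\iota_{\max\{2b_{\lambda/3},b_{\lambda/3}+D\}}(6\nu(2k+1)+5)\big),\qquad \widehat\lambda_k:=\frac{\lambda}{3(\gamma(\iota_{2b_{\lambda/3}}(2\nu(2k+1)+1))+1)},$$ $$\Phi'(\lambda,k,N):=\Phi(\lambda2^{-(k+N+2)},k,N),$$ and, with the abbreviation $\lambda^*:=\frac{\lambda}{2\gamma(\iota_{b_{\lambda/2}+D}(3k+2))}$ (depending on $\lambda,k$) and $\tilde g(n):=n+g(n)$ (with iterates $\tilde g^{(j)}$), $$\Psi(\lambda,k,g,q):=N^{\lambda,k}_{g,q}:=\tilde g^{(q\cdot Z_{f,h,b_0}(\lambda^*,3k+2))}(0),$$ $$\tilde Z(\lambda,k,g,q):=\zeta\big(p_{f,h,b_0}(\lambda^*,3k+2,N^{\lambda,k}_{g,q}),\ e_{f,h,b_0}(\lambda^*,3k+2,N^{\lambda,k}_{g,q}),\ N^{\lambda,k}_{g,q}\big),$$ where $Z_{f,h,b_0},e_{f,h,b_0},p_{f,h,b_0}$ are the explicit functions given in the context.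
   Context: Setting: $(\Omega,\mathsf F,\mathbb P)$ is a probability space with filtration $\mathcal F=(\mathcal F_n)$; $(X,d)$ is a metric space with Borel $\sigma$-algebra and a fixed point $o\in X$; $X_0\subseteq X$ is totally bounded; $\emptyset\ne F=\bigcap_{k\in\mathbb N}AF_k$, where $(AF_k)$ are measurable sets with $AF_{k+1}\subseteq AF_k\subseteq X_0$ for all $k$. $[n;m]:=[n,m]\cap\mathbb N$, $0\in\mathbb N$. $\ell^1_+(\mathcal F)$ is the set of sequences of nonnegative random variables adapted to $\mathcal F$ whose sum is almost surely finite. Modulus of total boundedness for $A\subseteq X$: a function $\gamma:\mathbb N\to\mathbb N$ such that for all $k$ and every sequence $(y_n)\subseteq A$ there are $0\le i<j\le\gamma(k)$ with $d(y_i,y_j)\le\frac1{k+1}$. Modulus of absolute continuity for an integrable random variable $Y$: a function $\mu:(0,\infty)\to(0,\infty)$ such that for all $\varepsilon>0$ and measurable $A\in\mathsf F$, $\mathbb P(A)<\mu(\varepsilon)$ implies $\mathbb E[|Y|\mathbf 1_A]\le\varepsilon$. The functions $Z,e,p$: for $K>0$, $\lambda,\varepsilon>0$ and $N\ge1$ put $\mu^M_N(\varepsilon):=\min\{\mu_n(\varepsilon)\mid n\le N\}$, $\alpha:=f(\lambda/4)$, $\beta:=\max\{2f(\lambda/10),2\alpha+1,16(K+\alpha)/\lambda\}$, $\varepsilon_0:=\frac{\varepsilon^2}{256Nh(\lambda/10)^2}$, $\lambda_0:=\min\{\mu^M_e(\frac{\varepsilon^2}{512e^2h(\lambda/10)^2})\mid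 1\le e\le N\}$, and $$Z_{f,h,K}(\lambda,\varepsilon):=4\Big\lceil\frac{2^{17}(K+f(\lambda/4)+1)^2h(\lambda/10)^2}{\lambda^2\varepsilon^2}\Big\rceil,$$ $$e_{f,h,K}(\lambda,\varepsilon,N):=\min\Big\{\frac{\varepsilon_0\lambda_0}{8N},\frac{\lambda(\beta/2+\alpha)}8,\frac{\varepsilon}{2N}\Big\},\qquad p_{f,h,K}(\lambda,\varepsilon,N):=\min\Big\{\mu^M_N\Big(\frac{\varepsilon_0\lambda_0}{16N}\Big),\mu^M_N\Big(\frac{\varepsilon}{8N^2}\Big)\Big\}.$$ For $N=0$ put $e_{f,h,K}:=p_{f,h,K}:=1$. Conventions: when a natural number $k$ is given in place of the real argument $\varepsilon$ of $Z,e,p$, this means $\varepsilon=\frac1{k+1}$. When a real $s>0$ is given in place of the natural-number argument $r$ of $\zeta$, this means the least $r\in\mathbb N$ with $\frac1{r+1}<s$. If the interval $[m;\Phi'(\mu,l,m)]$ in the definition of $h^\mu_l(m)$ is empty, put $h^\mu_l(m):=0$. The function $h:(0,\infty)\to\mathbb N$ (bounding the product) and the functions $h^\mu_l:\mathbb N\to\mathbb N$ are different objects. "Increasing" means strictly increasing. *)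

theory Defs
  imports "HOL-Probability.Probability"
begin

section \<open>Sequences of random variables and moduli\<close>

definition adapted :: "(nat \<Rightarrow> 'w measure) \<Rightarrow> (nat \<Rightarrow> 'w \<Rightarrow> 'a::topological_space) \<Rightarrow> bool" where
  "adapted F X \<longleftrightarrow> (\<forall>n. X n \<in> F n \<rightarrow>\<^sub>M borel)"

definition l1_plus :: "'w measure \<Rightarrow> (nat \<Rightarrow> 'w measure) \<Rightarrow> (nat \<Rightarrow> 'w \<Rightarrow> real) set" where
  "l1_plus M F = {Y. adapted F Y \<and> (\<forall>n. \<forall>\<omega>\<in>space M. 0 \<le> Y n \<omega>)
     \<and> (AE \<omega> in M. summable (\<lambda>n. Y n \<omega>))}"

definition total_boundedness_modulus :: "'x::metric_space set \<Rightarrow> (nat \<Rightarrow> nat) \<Rightarrow> bool" where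
  "total_boundedness_modulus A \<gamma> \<longleftrightarrow>
     (\<forall>k. \<forall>y :: nat \<Rightarrow> 'x. range y \<subseteq> A \<longrightarrow>
        (\<exists>i j. i < j \<and> j \<le> \<gamma> k \<and> dist (y i) (y j) \<le> 1 / (real k + 1)))"

definition absolute_continuity_modulus ::
    "'w measure \<Rightarrow> ('w \<Rightarrow> real) \<Rightarrow> (real \<Rightarrow> real) \<Rightarrow> bool" where
  "absolute_continuity_modulus M Y \<mu> \<longleftrightarrow>
     integrable M Y \<and>
     (\<forall>\<epsilon>>0. \<mu> \<epsilon> > 0 \<and>
        (\<forall>A\<in>sets M. measure M A < \<mu> \<epsilon> \<longrightarrow>
           (\<integral>\<omega>. \<bar>Y \<omega>\<bar> * indicator A \<omega> \<partial>M) \<le> \<epsilon>))"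

definition uniform_continuity_modulus :: "(real \<Rightarrow> real) \<Rightarrow> (real \<Rightarrow> nat \<Rightarrow> nat) \<Rightarrow> bool" where
  "uniform_continuity_modulus G \<iota> \<longleftrightarrow>
     (\<forall>b>0. \<forall>k. \<forall>s\<in>{0..b}. \<forall>t\<in>{0..b}.
        \<bar>s - t\<bar> \<le> 1 / (real (\<iota> b k) + 1) \<longrightarrow> \<bar>G s - G t\<bar> \<le> 1 / (real k + 1))"

definition inverse_continuity_modulus :: "(real \<Rightarrow> real) \<Rightarrow> (nat \<Rightarrow> nat) \<Rightarrow> bool" where
  "inverse_continuity_modulus G \<nu> \<longleftrightarrow>
     (\<forall>k. \<forall>s\<ge>0. G s \<le> 1 / (real (\<nu> k) + 1) \<longrightarrow> s \<le> 1 / (real k + 1))"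

text \<open>For a nonseparable metric space the distance of two random variables need not be measurable.
  Since \<open>measure M E = 0\<close> for nonmeasurable \<open>E\<close>, probabilities of events about
  \<open>dist (x i \<omega>) (x j \<omega>)\<close> are to be stated with \<open>outer_measure_of M\<close>, which agrees with
  \<open>emeasure M\<close> on \<open>sets M\<close>.\<close>

section \<open>The rate of metastability\<close>

text \<open>Moduli with domain \<open>(0,\<infinity>)\<close> are total functions on \<open>real\<close>, of which only the values at
  positive arguments are constrained by the hypotheses on them.\<close>

text \<open>The reading of a real number \<open>s > 0\<close> as an index \<open>r\<close>.\<close>

definition least_index :: "real \<Rightarrow> nat" where
  "least_index s = (LEAST r. 1 / (real r + 1) < s)"

context
  fixes f h :: "real \<Rightarrow> nat"
    and K :: real
    and \<mu> :: "nat \<Rightarrow> real \<Rightarrow> real"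
begin

definition rate_Z :: "real \<Rightarrow> real \<Rightarrow> nat" where
  "rate_Z lam \<epsilon> =
     4 * nat \<lceil>2 ^ 17 * (K + real (f (lam / 4)) + 1)\<^sup>2 * (real (h (lam / 10)))\<^sup>2 / (lam\<^sup>2 * \<epsilon>\<^sup>2)\<rceil>"

definition mu_min :: "nat \<Rightarrow> real \<Rightarrow> real" where
  "mu_min N \<epsilon> = Min {\<mu> n \<epsilon> | n. n \<le> N}"

definition rate_alpha :: "real \<Rightarrow> real" where
  "rate_alpha lam = real (f (lam / 4))"

definition rate_beta :: "real \<Rightarrow> real" where
  "rate_beta lam =
     Max {2 * real (f (lam / 10)), 2 * rate_alpha lam + 1, 16 * (K + rate_alpha lam) / lam}"

definition rate_eps0 :: "real \<Rightarrow> real \<Rightarrow> nat \<Rightarrow> real" where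
  "rate_eps0 lam \<epsilon> N = \<epsilon>\<^sup>2 / (256 * real N * (real (h (lam / 10)))\<^sup>2)"

definition rate_lam0 :: "real \<Rightarrow> real \<Rightarrow> nat \<Rightarrow> real" where
  "rate_lam0 lam \<epsilon> N =
     Min {mu_min e (\<epsilon>\<^sup>2 / (512 * (real e)\<^sup>2 * (real (h (lam / 10)))\<^sup>2)) | e. 1 \<le> e \<and> e \<le> N}"

definition rate_e :: "real \<Rightarrow> real \<Rightarrow> nat \<Rightarrow> real" where
  "rate_e lam \<epsilon> N = (if N = 0 then 1 else
     Min {rate_eps0 lam \<epsilon> N * rate_lam0 lam \<epsilon> N / (8 * real N),
          lam * (rate_beta lam / 2 + rate_alpha lam) / 8,
          \<epsilon> / (2 * real N)})"

definition rate_p :: "real \<Rightarrow> real \<Rightarrow> nat \<Rightarrow> real" where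
  "rate_p lam \<epsilon> N = (if N = 0 then 1 else
     min (mu_min N (rate_eps0 lam \<epsilon> N * rate_lam0 lam \<epsilon> N / (16 * real N)))
         (mu_min N (\<epsilon> / (8 * (real N)\<^sup>2))))"

end

context
  fixes f h :: "real \<Rightarrow> nat"
    and b0 :: real
    and \<mu> :: "nat \<Rightarrow> real \<Rightarrow> real"
    and \<zeta> :: "real \<Rightarrow> nat \<Rightarrow> nat \<Rightarrow> nat"
    and \<Phi> :: "real \<Rightarrow> nat \<Rightarrow> nat \<Rightarrow> nat"
    and b :: "real \<Rightarrow> nat"
    and D :: real
    and \<gamma> :: "nat \<Rightarrow> nat"
    and \<iota> :: "real \<Rightarrow> nat \<Rightarrow> nat"
    and \<nu> :: "nat \<Rightarrow> nat"
begin

definition lam_star :: "real \<Rightarrow> nat \<Rightarrow> real" where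
  "lam_star lam k = lam / (2 * real (\<gamma> (\<iota> (real (b (lam / 2)) + D) (3 * k + 2))))"

text \<open>The natural number \<open>3k+2\<close> as an argument of \<open>rate_Z\<close>, \<open>rate_e\<close> and \<open>rate_p\<close> stands for
  the real \<open>1/((3k+2)+1)\<close>.\<close>

definition eps_of :: "nat \<Rightarrow> real" where
  "eps_of k = 1 / (real k + 1)"

definition Psi :: "real \<Rightarrow> nat \<Rightarrow> (nat \<Rightarrow> nat) \<Rightarrow> nat \<Rightarrow> nat" where
  "Psi lam k g q =
     ((\<lambda>n. n + g n) ^^ (q * rate_Z f h b0 (lam_star lam k) (eps_of (3 * k + 2)))) 0"

definition Z_tilde :: "real \<Rightarrow> nat \<Rightarrow> (nat \<Rightarrow> nat) \<Rightarrow> nat \<Rightarrow> nat" where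
  "Z_tilde lam k g q =
     \<zeta> (rate_p h \<mu> (lam_star lam k) (eps_of (3 * k + 2)) (Psi lam k g q))
       (least_index (rate_e f h b0 \<mu> (lam_star lam k) (eps_of (3 * k + 2)) (Psi lam k g q)))
       (Psi lam k g q)"

definition Phi' :: "real \<Rightarrow> nat \<Rightarrow> nat \<Rightarrow> nat" where
  "Phi' lam k N = \<Phi> (lam / 2 ^ (k + N + 2)) k N"

text \<open>The counterfunction \<open>h\<^sup>\<mu>\<^sub>l\<close> of the paper, with its dependence on \<open>g\<close> made explicit; it is
  unrelated to \<open>h\<close> and to the moduli \<open>\<mu>\<close>.\<close>

definition h_fun :: "(nat \<Rightarrow> nat) \<Rightarrow> real \<Rightarrow> nat \<Rightarrow> nat \<Rightarrow> nat" where
  "h_fun g mu l m =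
     (if {m..Phi' mu l m} = {} then 0 else Max {m' + g m' | m'. m' \<in> {m..Phi' mu l m}} - m)"

definition net_index :: "real \<Rightarrow> nat \<Rightarrow> nat" where
  "net_index lam k = \<gamma> (\<iota> (2 * real (b (lam / 3))) (2 * \<nu> (2 * k + 1) + 1))"

definition lam_hat :: "real \<Rightarrow> nat \<Rightarrow> real" where
  "lam_hat lam k = lam / (3 * (real (net_index lam k) + 1))"

definition p_seq :: "real \<Rightarrow> nat \<Rightarrow> nat" where
  "p_seq lam k =
     \<gamma> (\<iota> (max (2 * real (b (lam / 3))) (real (b (lam / 3)) + D)) (6 * \<nu> (2 * k + 1) + 5))"

function k_seq :: "real \<Rightarrow> nat \<Rightarrow> (nat \<Rightarrow> nat) \<Rightarrow> nat \<Rightarrow> nat" where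
  "k_seq lam k g 0 = max (6 * \<nu> (2 * k + 1) + 5) k"
| "k_seq lam k g (Suc j) =
     Max ((\<lambda>i. max (Z_tilde (lam_hat lam k) (k_seq lam k g i)
                              (h_fun g (lam / 3) (k_seq lam k g i)) (p_seq lam k))
                    (k_seq lam k g i)) ` {..j})"
  by pat_completeness auto
termination
  by (relation "Wellfounded.measure (\<lambda>(lam, k, g, j). j)") auto

definition Delta_i :: "real \<Rightarrow> nat \<Rightarrow> (nat \<Rightarrow> nat) \<Rightarrow> nat \<Rightarrow> nat" where
  "Delta_i lam k g i =
     Max {Phi' (lam / 3) (k_seq lam k g i) m | m.
            m \<le> Psi (lam_hat lam k) (k_seq lam k g i)
                  (h_fun g (lam / 3) (k_seq lam k g i)) (p_seq lam k)}"

definition Delta :: "real \<Rightarrow> nat \<Rightarrow> (nat \<Rightarrow> nat) \<Rightarrow> nat" where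
  "Delta lam k g = Max {Delta_i lam k g i | i. i \<in> {0..net_index lam k}}"

end

end

theory Submission
  imports Defs
begin

text \<open>
  For a fixed point \<open>z\<close> of a late approximant, \<open>X n = G (dist (x n \<omega>) z)\<close> satisfies the inequality of
  Robbins and Siegmund, \<open>E[X (n+1) | F n] \<le> (1 + chi n) * X n + eta n\<close> up to a small error, outside
  of rare events. Dividing by the product of the factors \<open>1 + chi i\<close>, adding the unspent part of a budget
  for the sum of the \<open>eta i\<close> and killing the process when the budget is exhausted gives a nonnegative
  supermartingale \<open>W\<close> up to an excess of total expectation at most 1 (\<open>compensated_step\<close>,
  \<open>fluctuation_count\<close>).

  Truncated at a level \<open>c\<close>, such a process cannot oscillate often: \<open>u = c - min W c\<close> is a bounded
  submartingale, so by optional stopping \<open>\<delta>\<^sup>2\<close> times the probability of an oscillation by \<open>\<delta>\<close> on an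
  interval is bounded by the increase of the expectation of \<open>u\<^sup>2\<close> over the interval. Summed over
  consecutive intervals this is at most of the order of \<open>c\<close> times the expectation of \<open>W 0\<close>
  (\<open>oscillation_sum\<close>). With \<open>c\<close> of the order \<open>1 / \<lambda>\<close>, chosen by the maximal inequality, fewer than
  \<open>rate_Z\<close> consecutive intervals are bad in the sense that \<open>X\<close> oscillates by more than \<open>\<epsilon>\<close> on them with
  probability at least \<open>\<lambda>\<close> (\<open>bad_interval_count\<close>, \<open>point_fluctuation_count\<close>).

  By the pigeonhole principle there is then an interval on which the fluctuations are small for all
  points of a finite net (\<open>stable_interval\<close>), hence for all points of the approximant (\<open>phase\<close>). In
  the interval of each phase the sequence visits an approximant. Among \<open>net_index + 1\<close> visited points two
  are close, and the later of them is an admissible \<open>z\<close> for the earlier phase, in which the distance to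
  \<open>z\<close> is small at the time of the visit and therefore remains so (\<open>metastability\<close>). Almost sure
  convergence follows since the rate exists for every \<open>g\<close> (\<open>metastable_imp_AE_Cauchy\<close>).
\<close>

section \<open>Supermartingales up to a small excess\<close>

locale filtered_prob_space = prob_space M for M :: "'w measure" +
  fixes F :: "nat \<Rightarrow> 'w measure"
  assumes subalg: "subalgebra M (F n)"
    and filt: "filtration (space M) F"
begin

lemma space_F [simp]: "space (F n) = space M"
  using filt by (simp add: filtration.space_F)

lemma measurable_F_mono:
  assumes "f \<in> measurable (F m) N" "m \<le> n"
  shows "f \<in> measurable (F n) N"
proof -
  have "sets (F m) \<subseteq> sets (F n)"
    using filt assms(2) by (simp add: filtration.sets_F_mono)
  then show ?thesis using assms(1) by (auto simp: measurable_def)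
qed

lemma measurable_F_M: "f \<in> measurable (F n) N \<Longrightarrow> f \<in> measurable M N"
  using subalg[of n] measurable_from_subalg by blast

lemma sets_F_M: "A \<in> sets (F n) \<Longrightarrow> A \<in> sets M"
  using subalg[of n] by (auto simp: subalgebra_def)

lemma integrable_bounded:
  fixes f :: "'w \<Rightarrow> real"
  assumes "f \<in> borel_measurable M" "\<And>\<omega>. \<omega> \<in> space M \<Longrightarrow> \<bar>f \<omega>\<bar> \<le> B"
  shows "integrable M f"
  using assms by (intro integrable_const_bound[where B = B]) auto

lemma integrable_bounded_mult:
  fixes f g :: "'w \<Rightarrow> real"
  assumes "g \<in> borel_measurable M" "\<And>\<omega>. \<omega> \<in> space M \<Longrightarrow> \<bar>g \<omega>\<bar> \<le> B" "integrable M f"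
  shows "integrable M (\<lambda>\<omega>. g \<omega> * f \<omega>)"
proof (rule Bochner_Integration.integrable_bound)
  show "integrable M (\<lambda>\<omega>. B * \<bar>f \<omega>\<bar>)" using assms(3) by auto
  show "(\<lambda>\<omega>. g \<omega> * f \<omega>) \<in> borel_measurable M" using assms by measurable
  show "AE \<omega> in M. norm (g \<omega> * f \<omega>) \<le> norm (B * \<bar>f \<omega>\<bar>)"
  proof (rule AE_I2)
    fix \<omega> assume "\<omega> \<in> space M"
    then have b: "\<bar>g \<omega>\<bar> \<le> B" using assms(2) by auto
    then have "\<bar>g \<omega>\<bar> * \<bar>f \<omega>\<bar> \<le> B * \<bar>f \<omega>\<bar>" by (intro mult_right_mono) auto
    then show "norm (g \<omega> * f \<omega>) \<le> norm (B * \<bar>f \<omega>\<bar>)" using b by (simp add: abs_mult)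
  qed
qed

lemma prob_le_expectation:
  fixes Y :: "'w \<Rightarrow> real"
  assumes "integrable M Y" "\<And>\<omega>. \<omega> \<in> space M \<Longrightarrow> 0 \<le> Y \<omega>"
    and "A \<in> sets M" "\<And>\<omega>. \<omega> \<in> A \<Longrightarrow> t \<le> Y \<omega>"
  shows "t * prob A \<le> expectation Y"
proof -
  have i: "integrable M (\<lambda>\<omega>. t * indicat_real A \<omega>)" using assms(3) by (auto simp: emeasure_eq_measure)
  have "t * prob A = expectation (\<lambda>\<omega>. t * indicat_real A \<omega>)"
    using assms(3) sets.sets_into_space[OF assms(3)] by (simp add: Int_absorb1 Int_absorb2)
  also have "\<dots> \<le> expectation Y"
    by (rule integral_mono[OF i assms(1)]) (auto simp: indicator_def assms)
  finally show ?thesis .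
qed

end

text \<open>The inequality \<open>E[W (n+1) | F n] \<le> W n + ex n\<close> is stated by testing against weights that are
    \<open>F n\<close>-measurable with values in \<open>[0,1]\<close>. Everything below integrates it against such weights,
    namely indicators of past events and past values of a bounded process, and in this form it passes
    to truncated, stopped and killed processes by choosing another weight.\<close>

locale almost_supermartingale = filtered_prob_space M F for M :: "'w measure" and F +
  fixes W ex :: "nat \<Rightarrow> 'w \<Rightarrow> real" and N :: nat
  assumes W_adapted: "W n \<in> borel_measurable (F n)"
    and W_nonneg: "\<omega> \<in> space M \<Longrightarrow> 0 \<le> W n \<omega>"
    and W_int: "integrable M (W n)"
    and ex_nonneg: "\<omega> \<in> space M \<Longrightarrow> 0 \<le> ex n \<omega>"
    and ex_int: "integrable M (ex n)"
    and W_step: "n < N \<Longrightarrow> H \<in> borel_measurable (F n) \<Longrightarrow>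
        (\<And>\<omega>. \<omega> \<in> space M \<Longrightarrow> 0 \<le> H \<omega> \<and> H \<omega> \<le> 1) \<Longrightarrow>
        expectation (\<lambda>\<omega>. H \<omega> * W (Suc n) \<omega>) \<le> expectation (\<lambda>\<omega>. H \<omega> * (W n \<omega> + ex n \<omega>))"
begin

lemma W_meas: "W n \<in> borel_measurable M"
  using W_adapted measurable_F_M by blast

lemma W_meas_le: "m \<le> n \<Longrightarrow> W m \<in> borel_measurable (F n)"
  using W_adapted measurable_F_mono by blast

lemma expectation_ex_nonneg: "0 \<le> expectation (ex n)"
  using ex_nonneg by (auto intro!: Bochner_Integration.integral_nonneg)

text \<open>Doob's maximal inequality, by killing. The second summand is the mass of \<open>W n\<close> on the paths
    that have stayed below \<open>c\<close>. In each step a first hit moves at least \<open>c\<close> times its probability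
    to the first summand, and the mass that survives grows by at most the excess.\<close>

lemma maximal_inequality_aux:
  assumes "0 \<le> c" "n \<le> N"
  shows "c * prob {\<omega> \<in> space M. \<exists>i<n. c \<le> W i \<omega>}
      + expectation (\<lambda>\<omega>. indicat_real {\<omega> \<in> space M. \<forall>i<n. W i \<omega> < c} \<omega> * W n \<omega>)
    \<le> expectation (W 0) + (\<Sum>i<n. expectation (ex i))"
  using assms(2)
proof (induction n)
  case 0
  have "expectation (\<lambda>\<omega>. indicat_real (space M) \<omega> * W 0 \<omega>) = expectation (W 0)"
    by (intro Bochner_Integration.integral_cong) (auto simp: indicator_def)
  then show ?case by simp
next
  case (Suc n)
  let ?A = "\<lambda>n. {\<omega> \<in> space M. \<forall>i<n. W i \<omega> < c}"
  let ?B = "\<lambda>n. {\<omega> \<in> space M. \<exists>i<n. c \<le> W i \<omega>}"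
  have AF: "?A (Suc n) \<in> sets (F n)"
  proof -
    have "{\<omega> \<in> space (F n). W i \<omega> < c} \<in> sets (F n)" if "i < Suc n" for i
    proof -
      have [measurable]: "W i \<in> borel_measurable (F n)" using W_meas_le that by auto
      show ?thesis by measurable
    qed
    then have "{\<omega> \<in> space (F n). \<forall>i\<in>{..<Suc n}. W i \<omega> < c} \<in> sets (F n)"
      by (intro sets.sets_Collect_finite_All') auto
    then show ?thesis by (simp only: space_F Ball_def lessThan_iff)
  qed
  note [measurable] = W_meas
  have Am [measurable]: "?A n \<in> sets M" "?A (Suc n) \<in> sets M"
    and Bm [measurable]: "?B n \<in> sets M" "?B (Suc n) \<in> sets M" by measurable
  have i: "integrable M (\<lambda>\<omega>. indicat_real A \<omega> * Y \<omega>)" if "integrable M Y" "A \<in> sets M" for A Y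
    using that by (intro integrable_bounded_mult[where B = 1]) (auto simp: indicator_def)
  have step: "expectation (\<lambda>\<omega>. indicat_real (?A (Suc n)) \<omega> * W (Suc n) \<omega>)
      \<le> expectation (\<lambda>\<omega>. indicat_real (?A (Suc n)) \<omega> * W n \<omega>) + expectation (ex n)"
  proof -
    have "expectation (\<lambda>\<omega>. indicat_real (?A (Suc n)) \<omega> * W (Suc n) \<omega>)
        \<le> expectation (\<lambda>\<omega>. indicat_real (?A (Suc n)) \<omega> * (W n \<omega> + ex n \<omega>))"
      by (rule W_step[OF _ borel_measurable_indicator[OF AF]]) (use Suc.prems in \<open>simp_all add: indicator_def\<close>)
    also have "\<dots> \<le> expectation (\<lambda>\<omega>. indicat_real (?A (Suc n)) \<omega> * W n \<omega> + ex n \<omega>)"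
      by (intro integral_mono i Bochner_Integration.integrable_add W_int ex_int Am)
        (simp add: indicator_def ex_nonneg)
    also have "\<dots> = expectation (\<lambda>\<omega>. indicat_real (?A (Suc n)) \<omega> * W n \<omega>) + expectation (ex n)"
      by (intro Bochner_Integration.integral_add i W_int ex_int Am)
    finally show ?thesis .
  qed
  have hit: "c * prob (?B (Suc n) - ?B n) + expectation (\<lambda>\<omega>. indicat_real (?A (Suc n)) \<omega> * W n \<omega>)
      \<le> expectation (\<lambda>\<omega>. indicat_real (?A n) \<omega> * W n \<omega>)"
  proof -
    let ?D = "?B (Suc n) - ?B n"
    have "c * prob ?D \<le> expectation (\<lambda>\<omega>. indicat_real ?D \<omega> * W n \<omega>)"
      by (rule prob_le_expectation[OF i[OF W_int]])
        (use W_nonneg in \<open>auto simp: indicator_def less_Suc_eq\<close>)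
    moreover have "expectation (\<lambda>\<omega>. indicat_real (?A n) \<omega> * W n \<omega>)
       = expectation (\<lambda>\<omega>. indicat_real ?D \<omega> * W n \<omega> + indicat_real (?A (Suc n)) \<omega> * W n \<omega>)"
      by (intro Bochner_Integration.integral_cong)
        (auto simp: indicator_def less_Suc_eq not_le not_less)
    moreover have "\<dots> = expectation (\<lambda>\<omega>. indicat_real ?D \<omega> * W n \<omega>)
        + expectation (\<lambda>\<omega>. indicat_real (?A (Suc n)) \<omega> * W n \<omega>)"
      by (intro Bochner_Integration.integral_add i W_int) auto
    ultimately show ?thesis by linarith
  qed
  have "prob (?B (Suc n)) = prob (?B n) + prob (?B (Suc n) - ?B n)"
  proof -
    have "?B (Suc n) = ?B n \<union> (?B (Suc n) - ?B n)" by (auto simp: less_Suc_eq)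
    then show ?thesis using finite_measure_Union[of "?B n" "?B (Suc n) - ?B n"] Bm by auto
  qed
  then have "c * prob (?B (Suc n)) = c * prob (?B n) + c * prob (?B (Suc n) - ?B n)"
    by (simp add: distrib_left)
  moreover have "c * prob (?B n) + expectation (\<lambda>\<omega>. indicat_real (?A n) \<omega> * W n \<omega>)
    \<le> expectation (W 0) + (\<Sum>i<n. expectation (ex i))" using Suc by simp
  ultimately show ?case using step hit by simp
qed

lemma maximal_inequality:
  assumes "0 \<le> c"
  shows "c * prob {\<omega> \<in> space M. \<exists>i\<le>N. c \<le> W i \<omega>}
    \<le> expectation (W 0) + (\<Sum>i<N. expectation (ex i))"
proof -
  let ?A = "{\<omega> \<in> space M. \<forall>i<N. W i \<omega> < c}"
  let ?B = "{\<omega> \<in> space M. \<exists>i<N. c \<le> W i \<omega>}"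
  let ?D = "{\<omega> \<in> ?A. c \<le> W N \<omega>}"
  note [measurable] = W_meas
  have i: "integrable M (\<lambda>\<omega>. indicat_real ?A \<omega> * W N \<omega>)"
    by (intro integrable_bounded_mult[where B = 1] W_int) (auto simp: indicator_def)
  have "c * prob ?D \<le> expectation (\<lambda>\<omega>. indicat_real ?A \<omega> * W N \<omega>)"
    by (rule prob_le_expectation[OF i]) (use W_nonneg in \<open>auto simp: indicator_def\<close>)
  moreover have "{\<omega> \<in> space M. \<exists>i\<le>N. c \<le> W i \<omega>} = ?B \<union> ?D"
    by (auto simp: le_less not_le not_less)
  moreover have "prob (?B \<union> ?D) \<le> prob ?B + prob ?D"
    by (rule measure_Un_le) measurable
  ultimately have "c * prob {\<omega> \<in> space M. \<exists>i\<le>N. c \<le> W i \<omega>} \<le> c * prob ?B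
      + expectation (\<lambda>\<omega>. indicat_real ?A \<omega> * W N \<omega>)"
    using mult_left_mono[of "prob (?B \<union> ?D)" "prob ?B + prob ?D" c] assms by (simp add: distrib_left)
  also have "\<dots> \<le> expectation (W 0) + (\<Sum>i<N. expectation (ex i))"
    by (rule maximal_inequality_aux[OF assms order_refl])
  finally show ?thesis .
qed

text \<open>The missing height below the level \<open>c\<close>. As \<open>min _ c\<close> is concave, this is, up to the excess, a
    submartingale; it has values in \<open>[0,c]\<close>, so that its square is one as well.\<close>

definition gap :: "real \<Rightarrow> nat \<Rightarrow> 'w \<Rightarrow> real" where
  "gap c n \<omega> = c - min (W n \<omega>) c"

lemma gap_bounds: "0 \<le> c \<Longrightarrow> \<omega> \<in> space M \<Longrightarrow> 0 \<le> gap c n \<omega> \<and> gap c n \<omega> \<le> c"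
  using W_nonneg[of \<omega> n] by (auto simp: gap_def)

lemma gap_adapted: "m \<le> n \<Longrightarrow> gap c m \<in> borel_measurable (F n)"
proof -
  assume "m \<le> n"
  then have [measurable]: "W m \<in> borel_measurable (F n)" by (rule W_meas_le)
  show ?thesis unfolding gap_def[abs_def] by measurable
qed

lemma gap_meas: "gap c n \<in> borel_measurable M"
  using gap_adapted[of n n] measurable_F_M by blast

text \<open>Where \<open>W n < c\<close>, replacing \<open>W (n+1)\<close> by its truncation only helps the supermartingale
    inequality; where \<open>W n \<ge> c\<close>, the gap vanishes and cannot decrease. Weights bounded by \<open>B\<close> are
    reduced to weights bounded by 1 by scaling.\<close>

lemma gap_step:
  assumes "0 \<le> c" "n < N" and H: "H \<in> borel_measurable (F n)"
    and b: "\<And>\<omega>. \<omega> \<in> space M \<Longrightarrow> 0 \<le> H \<omega> \<and> H \<omega> \<le> B"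
  shows "- B * expectation (ex n) \<le> expectation (\<lambda>\<omega>. H \<omega> * (gap c (Suc n) \<omega> - gap c n \<omega>))"
proof -
  have *: "- expectation (ex n) \<le> expectation (\<lambda>\<omega>. H \<omega> * (gap c (Suc n) \<omega> - gap c n \<omega>))"
    if H: "H \<in> borel_measurable (F n)" and b: "\<And>\<omega>. \<omega> \<in> space M \<Longrightarrow> 0 \<le> H \<omega> \<and> H \<omega> \<le> 1"
    for H
  proof -
    define L where "L = (\<lambda>\<omega>. H \<omega> * indicat_real {\<omega> \<in> space M. W n \<omega> < c} \<omega>)"
    have LF: "L \<in> borel_measurable (F n)"
    proof -
      have [measurable]: "W n \<in> borel_measurable (F n)" by (rule W_adapted)
      note H [measurable]
      have "{\<omega> \<in> space (F n). W n \<omega> < c} \<in> sets (F n)" by measurable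
      then have [measurable]: "{\<omega> \<in> space M. W n \<omega> < c} \<in> sets (F n)" by simp
      show ?thesis unfolding L_def by measurable
    qed
    have Lb: "0 \<le> L \<omega> \<and> L \<omega> \<le> 1" if "\<omega> \<in> space M" for \<omega>
      using b that by (auto simp: L_def indicator_def)
    note [measurable] = measurable_F_M[OF H] measurable_F_M[OF LF] W_meas gap_meas
    have Hi: "integrable M (\<lambda>\<omega>. H \<omega> * (gap c (Suc n) \<omega> - gap c n \<omega>))"
      using b gap_bounds[OF assms(1)]
      by (intro integrable_bounded_mult[where B = 1] Bochner_Integration.integrable_diff
          integrable_bounded[where B = c]) auto
    have Li: "integrable M (\<lambda>\<omega>. L \<omega> * (W n \<omega> + ex n \<omega>))" "integrable M (\<lambda>\<omega>. L \<omega> * W (Suc n) \<omega>)"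
      using Lb by (auto intro!: integrable_bounded_mult[where B = 1] W_int ex_int)
    have "expectation (\<lambda>\<omega>. L \<omega> * W (Suc n) \<omega>) \<le> expectation (\<lambda>\<omega>. L \<omega> * (W n \<omega> + ex n \<omega>))"
      by (rule W_step[OF assms(2) LF Lb])
    then have "0 \<le> expectation (\<lambda>\<omega>. L \<omega> * (W n \<omega> + ex n \<omega>) - L \<omega> * W (Suc n) \<omega>)"
      using Li by simp
    also have "\<dots> \<le> expectation (\<lambda>\<omega>. H \<omega> * (gap c (Suc n) \<omega> - gap c n \<omega>) + ex n \<omega>)"
    proof (intro integral_mono Bochner_Integration.integrable_diff
        Bochner_Integration.integrable_add Li Hi ex_int)
      fix \<omega> assume \<omega>: "\<omega> \<in> space M"
      have e: "0 \<le> ex n \<omega>" "H \<omega> * ex n \<omega> \<le> ex n \<omega>"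
        using ex_nonneg[OF \<omega>] b[OF \<omega>] by (auto simp: mult_left_le_one_le)
      show "L \<omega> * (W n \<omega> + ex n \<omega>) - L \<omega> * W (Suc n) \<omega>
        \<le> H \<omega> * (gap c (Suc n) \<omega> - gap c n \<omega>) + ex n \<omega>"
      proof (cases "W n \<omega> < c")
        case True
        then have L: "L \<omega> = H \<omega>" using \<omega> by (simp add: L_def)
        have "W n \<omega> - W (Suc n) \<omega> \<le> gap c (Suc n) \<omega> - gap c n \<omega>"
          using True by (auto simp: gap_def)
        then have "H \<omega> * (W n \<omega> - W (Suc n) \<omega>) \<le> H \<omega> * (gap c (Suc n) \<omega> - gap c n \<omega>)"
          using b[OF \<omega>] by (intro mult_left_mono) auto
        then show ?thesis using e by (simp add: L algebra_simps)
      next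
        case False
        then have "L \<omega> = 0" "gap c n \<omega> = 0" by (auto simp: L_def gap_def)
        then show ?thesis using e b[OF \<omega>] gap_bounds[OF assms(1) \<omega>, of "Suc n"] by simp
      qed
    qed
    also have "\<dots> = expectation (\<lambda>\<omega>. H \<omega> * (gap c (Suc n) \<omega> - gap c n \<omega>)) + expectation (ex n)"
      by (intro Bochner_Integration.integral_add Hi ex_int)
    finally show ?thesis by simp
  qed
  obtain \<omega> where "\<omega> \<in> space M" using not_empty by blast
  then have "0 \<le> B" using b by force
  show ?thesis
  proof (cases "B = 0")
    case True
    then have "expectation (\<lambda>\<omega>. H \<omega> * (gap c (Suc n) \<omega> - gap c n \<omega>)) = expectation (\<lambda>\<omega>. 0)"
      using b by (intro Bochner_Integration.integral_cong) force+
    then show ?thesis using True by simp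
  next
    case False
    then have B: "B > 0" using \<open>0 \<le> B\<close> by simp
    note H [measurable]
    have "- expectation (ex n) \<le> expectation (\<lambda>\<omega>. (H \<omega> / B) * (gap c (Suc n) \<omega> - gap c n \<omega>))"
      using b B by (intro *) auto
    also have "\<dots> = expectation (\<lambda>\<omega>. H \<omega> * (gap c (Suc n) \<omega> - gap c n \<omega>)) / B"
      by (simp flip: integral_divide_zero)
    finally show ?thesis using B by (simp add: field_simps)
  qed
qed

text \<open>The gap at the time \<open>min \<tau> (a + m)\<close>, where \<open>\<tau>\<close> is the first time after \<open>a\<close> at which the gap has
    moved by at least \<open>\<delta>\<close> from its value at \<open>a\<close>.\<close>

primrec stopped_gap :: "real \<Rightarrow> nat \<Rightarrow> real \<Rightarrow> nat \<Rightarrow> 'w \<Rightarrow> real" where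
  "stopped_gap c a \<delta> 0 \<omega> = gap c a \<omega>"
| "stopped_gap c a \<delta> (Suc m) \<omega> =
     (if \<delta> \<le> \<bar>stopped_gap c a \<delta> m \<omega> - gap c a \<omega>\<bar> then stopped_gap c a \<delta> m \<omega>
      else gap c (a + Suc m) \<omega>)"

lemma stopped_gap_adapted: "stopped_gap c a \<delta> m \<in> borel_measurable (F (a + m))"
proof (induction m)
  case 0
  have "stopped_gap c a \<delta> 0 = gap c a" by auto
  then show ?case using gap_adapted by simp
next
  case (Suc m)
  have [measurable]: "stopped_gap c a \<delta> m \<in> borel_measurable (F (a + Suc m))"
    using measurable_F_mono[OF Suc] by simp
  have [measurable]: "gap c a \<in> borel_measurable (F (a + Suc m))"
    "gap c (a + Suc m) \<in> borel_measurable (F (a + Suc m))"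
    by (rule gap_adapted; simp)+
  have "stopped_gap c a \<delta> (Suc m) = (\<lambda>\<omega>. if \<delta> \<le> \<bar>stopped_gap c a \<delta> m \<omega> - gap c a \<omega>\<bar>
      then stopped_gap c a \<delta> m \<omega> else gap c (a + Suc m) \<omega>)" by auto
  then show ?case by (simp del: stopped_gap.simps add_Suc_right)
qed

lemma stopped_gap_running:
  "\<bar>stopped_gap c a \<delta> m \<omega> - gap c a \<omega>\<bar> < \<delta> \<Longrightarrow> stopped_gap c a \<delta> m \<omega> = gap c (a + m) \<omega>"
  by (cases m) auto

lemma stopped_gap_hit:
  "i \<le> m \<Longrightarrow> \<delta> \<le> \<bar>gap c (a + i) \<omega> - gap c a \<omega>\<bar> \<Longrightarrow>
    \<delta> \<le> \<bar>stopped_gap c a \<delta> m \<omega> - gap c a \<omega>\<bar>"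
proof (induction m)
  case 0
  then show ?case by simp
next
  case (Suc m)
  then show ?case by (cases "i = Suc m") auto
qed

lemma stopped_gap_bounds:
  "0 \<le> c \<Longrightarrow> \<omega> \<in> space M \<Longrightarrow> 0 \<le> stopped_gap c a \<delta> m \<omega> \<and> stopped_gap c a \<delta> m \<omega> \<le> c"
proof (induction m)
  case 0 then show ?case using gap_bounds by simp
next
  case (Suc m) then show ?case using gap_bounds[of c \<omega> "a + Suc m"] by (simp del: add_Suc_right)
qed

text \<open>For the gap \<open>u\<close> and its stopped value \<open>R\<close>, a large oscillation forces \<open>(R - u a)\<^sup>2 \<ge> \<delta>\<^sup>2\<close>, and
    \<open>(R - u a)\<^sup>2 = R\<^sup>2 - (u a)\<^sup>2 - 2 * u a * (R - u a)\<close>. Optional stopping for the submartingale \<open>u\<close>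
    makes the last product almost nonnegative in expectation, and optional stopping for the
    submartingale \<open>u\<^sup>2\<close> replaces \<open>R\<close> by \<open>u b\<close>. The result telescopes over consecutive intervals.\<close>

lemma oscillation_interval:
  assumes c: "0 \<le> c" and \<delta>: "0 < \<delta>" and ab: "a \<le> b" "b \<le> N"
  shows "\<delta>\<^sup>2 * prob {\<omega> \<in> space M. \<exists>i\<in>{a..b}. \<delta> \<le> \<bar>gap c i \<omega> - gap c a \<omega>\<bar>}
    \<le> expectation (\<lambda>\<omega>. (gap c b \<omega>)\<^sup>2) - expectation (\<lambda>\<omega>. (gap c a \<omega>)\<^sup>2)
      + 4 * c * (\<Sum>i=a..<b. expectation (ex i))"
proof -
  let ?g = "gap c" and ?R = "stopped_gap c a \<delta>"
  have gm: "?g n \<in> borel_measurable M" for n by (rule gap_meas)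
  have Rm: "?R m \<in> borel_measurable M" for m by (rule measurable_F_M[OF stopped_gap_adapted])
  have int: "integrable M f" if "f \<in> borel_measurable M"
     "\<And>\<omega>. \<omega> \<in> space M \<Longrightarrow> \<bar>f \<omega>\<bar> \<le> c * c" for f
    using that by (rule integrable_bounded)
  have gb: "0 \<le> ?g n \<omega>" "?g n \<omega> \<le> c" "0 \<le> ?R m \<omega>" "?R m \<omega> \<le> c" if "\<omega> \<in> space M" for n m \<omega>
    using gap_bounds[OF c that] stopped_gap_bounds[OF c that] by auto
  have bd1: "\<bar>s * (t - u)\<bar> \<le> c * c"
    if "0 \<le> s" "s \<le> c" "0 \<le> t" "t \<le> c" "0 \<le> u" "u \<le> c" for s t u
  proof -
    have "\<bar>s\<bar> * \<bar>t - u\<bar> \<le> c * c" using that by (intro mult_mono) auto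
    then show ?thesis by (simp add: abs_mult)
  qed
  have bd2: "\<bar>s\<^sup>2\<bar> \<le> c * c" if "0 \<le> s" "s \<le> c" for s
    using that by (auto simp: power2_eq_square intro!: mult_mono)
  have bd3: "\<bar>(s - t)\<^sup>2\<bar> \<le> c * c" if "0 \<le> s" "s \<le> c" "0 \<le> t" "t \<le> c" for s t
  proof -
    have "\<bar>s - t\<bar> * \<bar>s - t\<bar> \<le> c * c" using that by (intro mult_mono) auto
    then show ?thesis by (simp add: power2_eq_square abs_mult)
  qed
  have sq: "integrable M (\<lambda>\<omega>. (?R m \<omega>)\<^sup>2)" "integrable M (\<lambda>\<omega>. (?g n \<omega>)\<^sup>2)" for m n
  proof -
    have [measurable]: "?R m \<in> borel_measurable M" "?g n \<in> borel_measurable M"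
      using Rm gm by auto
    show "integrable M (\<lambda>\<omega>. (?R m \<omega>)\<^sup>2)"
      by (rule int) (measurable, (rule bd2; rule gb))
    show "integrable M (\<lambda>\<omega>. (?g n \<omega>)\<^sup>2)"
      by (rule int) (measurable, (rule bd2; rule gb))
  qed
  have mi: "integrable M (\<lambda>\<omega>. ?g a \<omega> * (?R m \<omega> - ?g a \<omega>))" for m
  proof -
    have [measurable]: "?R m \<in> borel_measurable M" "?g a \<in> borel_measurable M"
      using Rm gm by auto
    show ?thesis by (rule int) (measurable, (rule bd1; rule gb))
  qed
  have dsq: "integrable M (\<lambda>\<omega>. (?R m \<omega> - ?g a \<omega>)\<^sup>2)" for m
  proof -
    have [measurable]: "?R m \<in> borel_measurable M" "?g a \<in> borel_measurable M"
      using Rm gm by auto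
    show ?thesis by (rule int) (measurable, (rule bd3; rule gb))
  qed
  have ind: "integrable M (\<lambda>\<omega>. indicat_real A \<omega> * f \<omega>)"
    if "A \<in> sets M" "integrable M f" for A f
    using that by (intro integrable_bounded_mult[where B = 1]) (auto simp: indicator_def)
  define Hit where "Hit m = {\<omega> \<in> space M. \<delta> \<le> \<bar>?R m \<omega> - ?g a \<omega>\<bar>}" for m
  have HitF: "Hit m \<in> sets (F (a + m))" for m
  proof -
    have [measurable]: "?R m \<in> borel_measurable (F (a + m))" "?g a \<in> borel_measurable (F (a + m))"
      by (auto intro: stopped_gap_adapted gap_adapted)
    have "{\<omega> \<in> space (F (a + m)). \<delta> \<le> \<bar>?R m \<omega> - ?g a \<omega>\<bar>} \<in> sets (F (a + m))" by measurable
    then show ?thesis by (simp add: Hit_def)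
  qed
  have [measurable]: "Hit m \<in> sets M" for m using HitF sets_F_M by blast
  \<comment> \<open>Optional stopping for the gap with the weight \<open>gap c a\<close>, known at time \<open>a\<close>: an increment
    counts only as long as the process has not been stopped.\<close>
  have I1: "- c * (\<Sum>i<m. expectation (ex (a + i))) \<le> expectation (\<lambda>\<omega>. ?g a \<omega> * (?R m \<omega> - ?g a \<omega>))"
    if "a + m \<le> b" for m
    using that
  proof (induction m)
    case 0
    then show ?case by simp
  next
    case (Suc m)
    define H where "H = (\<lambda>\<omega>. ?g a \<omega> * indicat_real (space M - Hit m) \<omega>)"
    have "- c * expectation (ex (a + m)) \<le> expectation (\<lambda>\<omega>. H \<omega> * (?g (Suc (a + m)) \<omega> - ?g (a + m) \<omega>))"
    proof (rule gap_step[OF c])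
      show "a + m < N" using Suc.prems ab by simp
      have [measurable]: "?g a \<in> borel_measurable (F (a + m))" by (rule gap_adapted) simp
      have [measurable]: "space M - Hit m \<in> sets (F (a + m))"
        using sets.compl_sets[OF HitF[of m]] by simp
      show "H \<in> borel_measurable (F (a + m))" unfolding H_def by measurable
      show "0 \<le> H \<omega> \<and> H \<omega> \<le> c" if "\<omega> \<in> space M" for \<omega>
        using gb[OF that] c by (auto simp: H_def indicator_def)
    qed
    also have "\<dots> = expectation (\<lambda>\<omega>. ?g a \<omega> * (?R (Suc m) \<omega> - ?g a \<omega>) - ?g a \<omega> * (?R m \<omega> - ?g a \<omega>))"
      by (intro Bochner_Integration.integral_cong)
        (auto simp: H_def indicator_def Hit_def not_le right_diff_distrib dest: stopped_gap_running)
    also have "\<dots> = expectation (\<lambda>\<omega>. ?g a \<omega> * (?R (Suc m) \<omega> - ?g a \<omega>))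
        - expectation (\<lambda>\<omega>. ?g a \<omega> * (?R m \<omega> - ?g a \<omega>))"
      by (intro Bochner_Integration.integral_diff mi)
    finally have "- c * expectation (ex (a + m)) \<le> expectation (\<lambda>\<omega>. ?g a \<omega> * (?R (Suc m) \<omega> - ?g a \<omega>))
        - expectation (\<lambda>\<omega>. ?g a \<omega> * (?R m \<omega> - ?g a \<omega>))" .
    then show ?case using Suc by (simp add: algebra_simps)
  qed
  \<comment> \<open>Optional stopping for the squared gap: continuing after the stopping time only adds, because
    \<open>v\<^sup>2 - u\<^sup>2 \<ge> 2 * u * (v - u)\<close>.\<close>
  have I2: "expectation (\<lambda>\<omega>. (?R m \<omega>)\<^sup>2)
      \<le> expectation (\<lambda>\<omega>. (?g (a + m) \<omega>)\<^sup>2) + 2 * c * (\<Sum>i<m. expectation (ex (a + i)))"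
    if "a + m \<le> b" for m
    using that
  proof (induction m)
    case 0
    then show ?case by simp
  next
    case (Suc m)
    let ?d = "\<lambda>\<omega>. ?g (a + m) \<omega> * indicat_real (Hit m) \<omega>"
    have "- c * expectation (ex (a + m)) \<le> expectation (\<lambda>\<omega>. ?d \<omega> * (?g (Suc (a + m)) \<omega> - ?g (a + m) \<omega>))"
    proof (rule gap_step[OF c])
      show "a + m < N" using Suc.prems ab by simp
      have [measurable]: "?g (a + m) \<in> borel_measurable (F (a + m))" by (rule gap_adapted) simp
      note HitF[measurable]
      show "?d \<in> borel_measurable (F (a + m))" by measurable
      show "0 \<le> ?d \<omega> \<and> ?d \<omega> \<le> c" if "\<omega> \<in> space M" for \<omega>
        using gb[OF that] c by (auto simp: indicator_def)
    qed
    then have "- (2 * c) * expectation (ex (a + m))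
        \<le> expectation (\<lambda>\<omega>. 2 * (?d \<omega> * (?g (Suc (a + m)) \<omega> - ?g (a + m) \<omega>)))"
      by simp
    also have "\<dots> \<le> expectation (\<lambda>\<omega>. ((?g (a + Suc m) \<omega>)\<^sup>2 - (?R (Suc m) \<omega>)\<^sup>2) -
        ((?g (a + m) \<omega>)\<^sup>2 - (?R m \<omega>)\<^sup>2))"
    proof (rule integral_mono)
      have "integrable M (\<lambda>\<omega>. indicat_real (Hit m) \<omega> * (?g (a + m) \<omega> * (?g (Suc (a + m)) \<omega> - ?g (a + m) \<omega>)))"
      proof (rule ind[OF _ int])
        have [measurable]: "?g (a + m) \<in> borel_measurable M" "?g (Suc (a + m)) \<in> borel_measurable M"
          using gm by auto
        show "Hit m \<in> sets M"
          "(\<lambda>\<omega>. ?g (a + m) \<omega> * (?g (Suc (a + m)) \<omega> - ?g (a + m) \<omega>)) \<in> borel_measurable M"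
          by measurable
      qed (rule bd1; rule gb)
      then show "integrable M (\<lambda>\<omega>. 2 * (?d \<omega> * (?g (Suc (a + m)) \<omega> - ?g (a + m) \<omega>)))"
        by (simp add: mult_ac)
      show "integrable M (\<lambda>\<omega>. ((?g (a + Suc m) \<omega>)\<^sup>2 - (?R (Suc m) \<omega>)\<^sup>2) -
        ((?g (a + m) \<omega>)\<^sup>2 - (?R m \<omega>)\<^sup>2))"
        by (intro Bochner_Integration.integrable_diff sq)
      fix \<omega> assume \<omega>: "\<omega> \<in> space M"
      show "2 * (?d \<omega> * (?g (Suc (a + m)) \<omega> - ?g (a + m) \<omega>))
        \<le> ((?g (a + Suc m) \<omega>)\<^sup>2 - (?R (Suc m) \<omega>)\<^sup>2) - ((?g (a + m) \<omega>)\<^sup>2 - (?R m \<omega>)\<^sup>2)"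
      proof (cases "\<omega> \<in> Hit m")
        case True
        then have "?R (Suc m) \<omega> = ?R m \<omega>" by (auto simp: Hit_def)
        moreover have "0 \<le> (?g (Suc (a + m)) \<omega> - ?g (a + m) \<omega>)\<^sup>2" by simp
        ultimately show ?thesis using True by (simp add: power2_eq_square algebra_simps)
      next
        case False
        then have "\<bar>?R m \<omega> - ?g a \<omega>\<bar> < \<delta>" using \<omega> by (auto simp: Hit_def)
        then have "?R m \<omega> = ?g (a + m) \<omega>" "?R (Suc m) \<omega> = ?g (a + Suc m) \<omega>"
          using stopped_gap_running by auto
        then show ?thesis using False by simp
      qed
    qed
    also have "\<dots> = (expectation (\<lambda>\<omega>. (?g (a + Suc m) \<omega>)\<^sup>2) - expectation (\<lambda>\<omega>. (?R (Suc m) \<omega>)\<^sup>2))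
       - (expectation (\<lambda>\<omega>. (?g (a + m) \<omega>)\<^sup>2) - expectation (\<lambda>\<omega>. (?R m \<omega>)\<^sup>2))"
      by (simp add: sq del: stopped_gap.simps add_Suc_right)
    finally show ?case using Suc by (simp add: algebra_simps)
  qed
  define m where "m = b - a"
  have m: "a + m = b" using ab by (simp add: m_def)
  have sm: "(\<Sum>i<m. expectation (ex (a + i))) = (\<Sum>i=a..<b. expectation (ex i))"
    using sum.shift_bounds_nat_ivl[of "\<lambda>i. expectation (ex i)" 0 a m] m
    by (simp add: atLeast0LessThan add.commute)
  have "\<delta>\<^sup>2 * prob {\<omega> \<in> space M. \<exists>i\<in>{a..b}. \<delta> \<le> \<bar>?g i \<omega> - ?g a \<omega>\<bar>}
      \<le> expectation (\<lambda>\<omega>. (?R m \<omega> - ?g a \<omega>)\<^sup>2)"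
  proof (rule prob_le_expectation)
    show "integrable M (\<lambda>\<omega>. (?R m \<omega> - ?g a \<omega>)\<^sup>2)" by (rule dsq)
    note gm [measurable]
    show "{\<omega> \<in> space M. \<exists>i\<in>{a..b}. \<delta> \<le> \<bar>?g i \<omega> - ?g a \<omega>\<bar>} \<in> sets M" by measurable
    fix \<omega> assume "\<omega> \<in> {\<omega> \<in> space M. \<exists>i\<in>{a..b}. \<delta> \<le> \<bar>?g i \<omega> - ?g a \<omega>\<bar>}"
    then obtain i where i: "a \<le> i" "i \<le> b" "\<delta> \<le> \<bar>?g i \<omega> - ?g a \<omega>\<bar>" by auto
    then have "\<delta> \<le> \<bar>?R m \<omega> - ?g a \<omega>\<bar>"
      using stopped_gap_hit[of "i - a" m \<delta> c a \<omega>] m by simp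
    then show "\<delta>\<^sup>2 \<le> (?R m \<omega> - ?g a \<omega>)\<^sup>2" using \<delta> by (metis abs_ge_zero abs_of_pos power2_abs power_mono less_imp_le)
  qed auto
  also have "\<dots> = expectation (\<lambda>\<omega>. (?R m \<omega>)\<^sup>2 - (?g a \<omega>)\<^sup>2 - 2 * (?g a \<omega> * (?R m \<omega> - ?g a \<omega>)))"
    by (intro Bochner_Integration.integral_cong) (auto simp: power2_eq_square algebra_simps)
  also have "\<dots> = expectation (\<lambda>\<omega>. (?R m \<omega>)\<^sup>2) - expectation (\<lambda>\<omega>. (?g a \<omega>)\<^sup>2)
      - 2 * expectation (\<lambda>\<omega>. ?g a \<omega> * (?R m \<omega> - ?g a \<omega>))"
    by (simp add: sq mi del: stopped_gap.simps)
  also have "\<dots> \<le> expectation (\<lambda>\<omega>. (?g b \<omega>)\<^sup>2) - expectation (\<lambda>\<omega>. (?g a \<omega>)\<^sup>2)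
      + 4 * c * (\<Sum>i=a..<b. expectation (ex i))"
    using I1[of m] I2[of m] m unfolding sm by simp
  finally show ?thesis .
qed

text \<open>After telescoping, \<open>(c - v)\<^sup>2 - (c - w)\<^sup>2 \<le> 2 * c * w\<close> for \<open>v, w\<close> in \<open>[0,c]\<close>, where \<open>w\<close> is the initial
    value, gives a bound that is linear in \<open>c\<close>. The trivial bound \<open>c\<^sup>2\<close> would cost another factor
    \<open>1 / \<lambda>\<close> later, when \<open>c\<close> is chosen of the order of \<open>1 / \<lambda>\<close>.\<close>

lemma oscillation_sum:
  fixes n :: "nat \<Rightarrow> nat"
  assumes c: "0 \<le> c" and \<delta>: "0 < \<delta>" and n: "n 0 = 0" "mono n" "n J \<le> N"
  shows "\<delta>\<^sup>2 * (\<Sum>j<J. prob {\<omega> \<in> space M. \<exists>i\<in>{n j..n (Suc j)}. \<delta> \<le> \<bar>gap c i \<omega> - gap c (n j) \<omega>\<bar>})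
    \<le> 2 * c * expectation (W 0) + 4 * c * (\<Sum>i<N. expectation (ex i))"
proof -
  let ?E = "\<lambda>k. expectation (\<lambda>\<omega>. (gap c k \<omega>)\<^sup>2) + 4 * c * (\<Sum>i<k. expectation (ex i))"
  have nle: "n i \<le> n j" if "i \<le> j" for i j using n(2) that by (simp add: mono_def)
  have "\<delta>\<^sup>2 * (\<Sum>j<J. prob {\<omega> \<in> space M. \<exists>i\<in>{n j..n (Suc j)}. \<delta> \<le> \<bar>gap c i \<omega> - gap c (n j) \<omega>\<bar>})
    \<le> (\<Sum>j<J. ?E (n (Suc j)) - ?E (n j))"
    unfolding sum_distrib_left[of "\<delta>\<^sup>2"]
  proof (rule sum_mono)
    fix j assume "j \<in> {..<J}"
    then have le: "n j \<le> n (Suc j)" "n (Suc j) \<le> N" using nle[of j "Suc j"] nle[of "Suc j" J] n(3) by auto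
    have "(\<Sum>i<n (Suc j). expectation (ex i)) = (\<Sum>i<n j. expectation (ex i)) + (\<Sum>i=n j..<n (Suc j). expectation (ex i))"
      using sum.atLeastLessThan_concat[of 0 "n j" "n (Suc j)" "\<lambda>i. expectation (ex i)"] le
      by (simp add: atLeast0LessThan)
    then show "\<delta>\<^sup>2 * prob {\<omega> \<in> space M. \<exists>i\<in>{n j..n (Suc j)}. \<delta> \<le> \<bar>gap c i \<omega> - gap c (n j) \<omega>\<bar>}
      \<le> ?E (n (Suc j)) - ?E (n j)"
      using oscillation_interval[OF c \<delta> le] by (simp add: algebra_simps)
  qed
  also have "\<dots> = ?E (n J) - ?E (n 0)"
    by (rule sum_lessThan_telescope)
  also have "\<dots> = expectation (\<lambda>\<omega>. (gap c (n J) \<omega>)\<^sup>2 - (gap c 0 \<omega>)\<^sup>2) + 4 * c * (\<Sum>i<n J. expectation (ex i))"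
  proof -
    have "integrable M (\<lambda>\<omega>. (gap c k \<omega>)\<^sup>2)" for k
      using gap_bounds[OF c] gap_meas
      by (intro integrable_bounded[where B = "c\<^sup>2"]) (auto simp: power_mono)
    then show ?thesis using n by simp
  qed
  also have "\<dots> \<le> expectation (\<lambda>\<omega>. 2 * c * W 0 \<omega>) + 4 * c * (\<Sum>i<N. expectation (ex i))"
  proof (rule add_mono)
    show "expectation (\<lambda>\<omega>. (gap c (n J) \<omega>)\<^sup>2 - (gap c 0 \<omega>)\<^sup>2) \<le> expectation (\<lambda>\<omega>. 2 * c * W 0 \<omega>)"
    proof (rule integral_mono)
      show "integrable M (\<lambda>\<omega>. 2 * c * W 0 \<omega>)" using W_int by simp
      show "integrable M (\<lambda>\<omega>. (gap c (n J) \<omega>)\<^sup>2 - (gap c 0 \<omega>)\<^sup>2)"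
        using gap_bounds[OF c] gap_meas
        by (intro Bochner_Integration.integrable_diff integrable_bounded[where B = "c\<^sup>2"])
          (auto simp: power_mono)
      fix \<omega> assume \<omega>: "\<omega> \<in> space M"
      define v where "v = gap c (n J) \<omega>"
      define w where "w = min (W 0 \<omega>) c"
      have v: "0 \<le> v" "v \<le> c" using gap_bounds[OF c \<omega>] by (auto simp: v_def)
      then have "v\<^sup>2 \<le> c\<^sup>2" by (simp add: power_mono)
      moreover have "c * w \<le> c * W 0 \<omega>" using c by (auto simp: w_def intro: mult_left_mono)
      moreover have "0 \<le> w\<^sup>2" by simp
      moreover have "(c - w)\<^sup>2 = c\<^sup>2 - 2 * (c * w) + w\<^sup>2" by (simp add: power2_eq_square algebra_simps)
      ultimately have "v\<^sup>2 - (c - w)\<^sup>2 \<le> 2 * (c * W 0 \<omega>)" by linarith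
      then have "v\<^sup>2 - (c - w)\<^sup>2 \<le> 2 * c * W 0 \<omega>" by simp
      then show "(gap c (n J) \<omega>)\<^sup>2 - (gap c 0 \<omega>)\<^sup>2 \<le> 2 * c * W 0 \<omega>"
        by (simp add: v_def w_def gap_def)
    qed
    show "4 * c * (\<Sum>i<n J. expectation (ex i)) \<le> 4 * c * (\<Sum>i<N. expectation (ex i))"
      using c n(3) expectation_ex_nonneg by (intro mult_left_mono sum_mono2) auto
  qed
  finally show ?thesis by simp
qed

end


section \<open>The Robbins-Siegmund transform\<close>

text \<open>Below the level \<open>B\<close> a nonnegative nondecreasing sequence makes at most \<open>B / d\<close> steps of size \<open>d\<close>.
    Taking expectations of the number of such steps gives the claim.\<close>

lemma (in filtered_prob_space) increment_count:
  fixes Y :: "nat \<Rightarrow> 'w \<Rightarrow> real"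
  assumes Y: "\<And>j. Y j \<in> borel_measurable M"
    and nonneg: "\<And>\<omega>. \<omega> \<in> space M \<Longrightarrow> 0 \<le> Y 0 \<omega>"
    and mono: "\<And>\<omega> j. \<omega> \<in> space M \<Longrightarrow> Y j \<omega> \<le> Y (Suc j) \<omega>"
    and B: "0 \<le> B" and d: "0 < d"
  shows "d * (\<Sum>j<J. prob {\<omega> \<in> space M. Y (Suc j) \<omega> < B \<and> d \<le> Y (Suc j) \<omega> - Y j \<omega>}) \<le> B"
proof -
  define A where "A j = {\<omega> \<in> space M. Y (Suc j) \<omega> < B \<and> d \<le> Y (Suc j) \<omega> - Y j \<omega>}" for j
  note Y[measurable]
  have A[measurable]: "A j \<in> sets M" for j unfolding A_def by measurable
  have pw: "(\<Sum>j<J. d * indicat_real (A j) \<omega>) \<le> min (Y J \<omega>) B" if \<omega>: "\<omega> \<in> space M" for \<omega> J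
  proof (induction J)
    case 0
    then show ?case using nonneg[OF \<omega>] B by simp
  next
    case (Suc J)
    show ?case
      using Suc mono[OF \<omega>, of J] by (cases "\<omega> \<in> A J") (auto simp: A_def)
  qed
  have "d * (\<Sum>j<J. prob (A j)) = expectation (\<lambda>\<omega>. \<Sum>j<J. d * indicat_real (A j) \<omega>)"
    using sets.sets_into_space[OF A]
    by (subst Bochner_Integration.integral_sum)
      (simp_all add: sum_distrib_left Int_absorb1 Int_absorb2 emeasure_eq_measure)
  also have "\<dots> \<le> expectation (\<lambda>\<omega>. B)"
  proof (rule integral_mono)
    show "integrable M (\<lambda>\<omega>. \<Sum>j<J. d * indicat_real (A j) \<omega>)"
      by (intro Bochner_Integration.integrable_sum integrable_mult_right)
        (simp add: emeasure_eq_measure)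
    show "(\<Sum>j<J. d * indicat_real (A j) \<omega>) \<le> B" if "\<omega> \<in> space M" for \<omega>
      using pw[OF that, of J] by simp
  qed simp
  finally show ?thesis by (simp add: A_def prob_space)
qed

locale quasi_supermartingale = filtered_prob_space M F for M :: "'w measure" and F +
  fixes X chi eta ex :: "nat \<Rightarrow> 'w \<Rightarrow> real" and N :: nat
  assumes X_adapted: "X n \<in> borel_measurable (F n)"
    and X_nonneg: "\<omega> \<in> space M \<Longrightarrow> 0 \<le> X n \<omega>"
    and X_int: "integrable M (X n)"
    and chi_adapted: "chi n \<in> borel_measurable (F n)"
    and chi_nonneg: "\<omega> \<in> space M \<Longrightarrow> 0 \<le> chi n \<omega>"
    and eta_adapted: "eta n \<in> borel_measurable (F n)"
    and eta_nonneg: "\<omega> \<in> space M \<Longrightarrow> 0 \<le> eta n \<omega>"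
    and ex_nonneg: "\<omega> \<in> space M \<Longrightarrow> 0 \<le> ex n \<omega>"
    and ex_int: "integrable M (ex n)"
    and X_step: "n < N \<Longrightarrow> AE \<omega> in M. real_cond_exp M (F n) (X (Suc n)) \<omega>
        \<le> (1 + chi n \<omega>) * X n \<omega> + eta n \<omega> + ex n \<omega>"
begin

definition growth :: "nat \<Rightarrow> 'w \<Rightarrow> real" where
  "growth n \<omega> = (\<Prod>i<n. 1 + chi i \<omega>)"

definition noise :: "nat \<Rightarrow> 'w \<Rightarrow> real" where
  "noise n \<omega> = (\<Sum>i<n. eta i \<omega>)"

text \<open>Division by \<open>growth\<close> removes the factors \<open>1 + chi\<close>. The term \<open>\<alpha> - noise n\<close> is the unspent part of a
    budget \<open>\<alpha>\<close> for the summands \<open>eta\<close>, and the process is killed when the budget is exhausted, which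
    keeps it nonnegative.\<close>

definition compensated :: "real \<Rightarrow> nat \<Rightarrow> 'w \<Rightarrow> real" where
  "compensated \<alpha> n \<omega> =
     (if noise n \<omega> < \<alpha> then X n \<omega> / growth n \<omega> + (\<alpha> - noise n \<omega>) else 0)"

lemma growth_ge_1: "\<omega> \<in> space M \<Longrightarrow> 1 \<le> growth n \<omega>"
  unfolding growth_def by (intro prod_ge_1) (simp add: chi_nonneg)

lemma growth_Suc_mono: "\<omega> \<in> space M \<Longrightarrow> growth n \<omega> \<le> growth (Suc n) \<omega>"
  using growth_ge_1[of \<omega> n] chi_nonneg[of \<omega> n]
  by (simp add: growth_def mult_le_cancel_left1)

lemma growth_mono: "\<omega> \<in> space M \<Longrightarrow> m \<le> n \<Longrightarrow> growth m \<omega> \<le> growth n \<omega>"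
  by (rule lift_Suc_mono_le[of "\<lambda>n. growth n \<omega>"]) (auto intro: growth_Suc_mono)

lemma noise_mono: "\<omega> \<in> space M \<Longrightarrow> m \<le> n \<Longrightarrow> noise m \<omega> \<le> noise n \<omega>"
  by (rule lift_Suc_mono_le[of "\<lambda>n. noise n \<omega>"]) (auto simp: noise_def eta_nonneg)

lemma noise_nonneg: "\<omega> \<in> space M \<Longrightarrow> 0 \<le> noise n \<omega>"
  unfolding noise_def by (intro sum_nonneg) (simp add: eta_nonneg)

lemma growth_predictable: "growth (Suc n) \<in> borel_measurable (F n)"
proof -
  have "(\<lambda>\<omega>. \<Prod>i<Suc n. 1 + chi i \<omega>) \<in> borel_measurable (F n)"
  proof (rule borel_measurable_prod)
    fix i assume "i \<in> {..<Suc n}"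
    then have [measurable]: "chi i \<in> borel_measurable (F n)"
      using measurable_F_mono[OF chi_adapted, of i n] by simp
    show "(\<lambda>\<omega>. 1 + chi i \<omega>) \<in> borel_measurable (F n)" by measurable
  qed
  then show ?thesis by (simp only: growth_def[abs_def])
qed

lemma noise_predictable: "noise (Suc n) \<in> borel_measurable (F n)"
proof -
  have "(\<lambda>\<omega>. \<Sum>i<Suc n. eta i \<omega>) \<in> borel_measurable (F n)"
  proof (rule borel_measurable_sum)
    fix i assume "i \<in> {..<Suc n}"
    then show "eta i \<in> borel_measurable (F n)"
      using measurable_F_mono[OF eta_adapted, of i n] by simp
  qed
  then show ?thesis by (simp only: noise_def[abs_def])
qed

lemma growth_adapted: "growth n \<in> borel_measurable (F n)"
proof (cases n)
  case 0
  then have "growth n = (\<lambda>\<omega>. 1)" by (auto simp: growth_def)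
  then show ?thesis by simp
next
  case (Suc m)
  then show ?thesis using measurable_F_mono[OF growth_predictable[of m], of n] by simp
qed

lemma noise_adapted: "noise n \<in> borel_measurable (F n)"
proof (cases n)
  case 0
  then have "noise n = (\<lambda>\<omega>. 0)" by (auto simp: noise_def)
  then show ?thesis by simp
next
  case (Suc m)
  then show ?thesis using measurable_F_mono[OF noise_predictable[of m], of n] by simp
qed

lemma growth_meas: "growth n \<in> borel_measurable M"
  by (rule measurable_F_M[OF growth_adapted])

lemma noise_meas: "noise n \<in> borel_measurable M"
  by (rule measurable_F_M[OF noise_adapted])

lemma X_meas: "X n \<in> borel_measurable M"
  by (rule measurable_F_M[OF X_adapted])

lemma compensated_adapted: "compensated \<alpha> n \<in> borel_measurable (F n)"
proof -
  note X_adapted[measurable] growth_adapted[measurable] noise_adapted[measurable]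
  show ?thesis unfolding compensated_def[abs_def] by measurable
qed

lemma compensated_nonneg:
  assumes "\<omega> \<in> space M" shows "0 \<le> compensated \<alpha> n \<omega>"
proof -
  have "0 \<le> X n \<omega> / growth n \<omega>"
    using X_nonneg[OF assms] growth_ge_1[OF assms, of n] by (intro divide_nonneg_pos) auto
  then show ?thesis by (simp add: compensated_def)
qed

lemma compensated_le:
  assumes "0 \<le> \<alpha>" "\<omega> \<in> space M" shows "compensated \<alpha> n \<omega> \<le> X n \<omega> + \<alpha>"
proof -
  have "X n \<omega> / growth n \<omega> \<le> X n \<omega> / 1"
    using X_nonneg[OF assms(2)] growth_ge_1[OF assms(2), of n] by (intro divide_left_mono) auto
  then show ?thesis
    using noise_nonneg[OF assms(2), of n] X_nonneg[OF assms(2), of n] assms(1)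
    by (auto simp: compensated_def)
qed

lemma compensated_int:
  assumes "0 \<le> \<alpha>" shows "integrable M (compensated \<alpha> n)"
proof (rule Bochner_Integration.integrable_bound)
  show "integrable M (\<lambda>\<omega>. X n \<omega> + \<alpha>)" using X_int by simp
  show "compensated \<alpha> n \<in> borel_measurable M" by (rule measurable_F_M[OF compensated_adapted])
  show "AE \<omega> in M. norm (compensated \<alpha> n \<omega>) \<le> norm (X n \<omega> + \<alpha>)"
  proof (rule AE_I2)
    fix \<omega> assume "\<omega> \<in> space M"
    then show "norm (compensated \<alpha> n \<omega>) \<le> norm (X n \<omega> + \<alpha>)"
      using compensated_le[OF assms, of \<omega> n] compensated_nonneg[of \<omega> \<alpha> n] by simp
  qed
qed

text \<open>Both \<open>growth (n+1)\<close> and \<open>noise (n+1)\<close> are known at time \<open>n\<close>. Hence the quotient by \<open>growth (n+1)\<close>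
    cancels the factor \<open>1 + chi n\<close>, the summand \<open>eta n\<close> is paid from the budget, and killing at the next
    step is an \<open>F n\<close>-measurable restriction to a nonnegative integrand. Only \<open>ex n\<close> remains.\<close>

lemma compensated_step:
  assumes \<alpha>: "0 \<le> \<alpha>" and n: "n < N" and H: "H \<in> borel_measurable (F n)"
    and b: "\<And>\<omega>. \<omega> \<in> space M \<Longrightarrow> 0 \<le> H \<omega> \<and> H \<omega> \<le> 1"
  shows "expectation (\<lambda>\<omega>. H \<omega> * compensated \<alpha> (Suc n) \<omega>)
    \<le> expectation (\<lambda>\<omega>. H \<omega> * (compensated \<alpha> n \<omega> + ex n \<omega>))"
proof -
  interpret fm: finite_measure_subalgebra M "F n"
    by unfold_locales (rule subalg)
  define J where "J = (\<lambda>\<omega>. if noise (Suc n) \<omega> < \<alpha> then H \<omega> else 0)"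
  define Q where "Q = (\<lambda>\<omega>. J \<omega> / growth (Suc n) \<omega>)"
  define T where "T = (\<lambda>\<omega>. J \<omega> * (\<alpha> - noise (Suc n) \<omega>))"
  note H[measurable] growth_predictable[measurable] noise_predictable[measurable]
  have JF[measurable]: "J \<in> borel_measurable (F n)" unfolding J_def by measurable
  have QF: "Q \<in> borel_measurable (F n)" unfolding Q_def by measurable
  have TF: "T \<in> borel_measurable (F n)" unfolding T_def by measurable
  have J: "0 \<le> J \<omega>" "J \<omega> \<le> H \<omega>" "J \<omega> \<le> 1" if "\<omega> \<in> space M" for \<omega>
    using b[OF that] by (auto simp: J_def)
  have Q: "0 \<le> Q \<omega>" "Q \<omega> \<le> 1" "Q \<omega> \<le> H \<omega>" if "\<omega> \<in> space M" for \<omega>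
  proof -
    show "0 \<le> Q \<omega>" using J[OF that] growth_ge_1[OF that, of "Suc n"] by (simp add: Q_def)
    have "Q \<omega> \<le> J \<omega> / 1"
      unfolding Q_def using J[OF that] growth_ge_1[OF that, of "Suc n"] by (intro divide_left_mono) auto
    then show "Q \<omega> \<le> 1" "Q \<omega> \<le> H \<omega>" using J[OF that] by auto
  qed
  have Tb: "\<bar>T \<omega>\<bar> \<le> \<alpha>" if "\<omega> \<in> space M" for \<omega>
  proof (cases "noise (Suc n) \<omega> < \<alpha>")
    case True
    have "\<bar>J \<omega>\<bar> * \<bar>\<alpha> - noise (Suc n) \<omega>\<bar> \<le> 1 * \<alpha>"
      using True noise_nonneg[OF that, of "Suc n"] J[OF that] by (intro mult_mono) auto
    then show ?thesis by (simp add: T_def abs_mult)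
  next
    case False
    then show ?thesis using \<alpha> by (simp add: T_def J_def)
  qed
  note measurable_F_M[OF H, measurable] measurable_F_M[OF QF, measurable]
    measurable_F_M[OF TF, measurable] X_meas[measurable]
  have iT: "integrable M T" by (rule integrable_bounded[OF _ Tb]) measurable
  have iQ: "integrable M (\<lambda>\<omega>. Q \<omega> * X (Suc n) \<omega>)"
    using Q by (intro integrable_bounded_mult[where B = 1] X_int) auto
  note ce = fm.real_cond_exp_intg[OF iQ QF X_meas]
  have iR: "integrable M (\<lambda>\<omega>. H \<omega> * (compensated \<alpha> n \<omega> + ex n \<omega>))"
    using b by (intro integrable_bounded_mult[where B = 1] Bochner_Integration.integrable_add
        compensated_int[OF \<alpha>] ex_int) auto
  have "expectation (\<lambda>\<omega>. H \<omega> * compensated \<alpha> (Suc n) \<omega>)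
      = expectation (\<lambda>\<omega>. Q \<omega> * X (Suc n) \<omega> + T \<omega>)"
    by (intro Bochner_Integration.integral_cong)
      (auto simp: compensated_def Q_def T_def J_def algebra_simps)
  also have "\<dots> = expectation (\<lambda>\<omega>. Q \<omega> * real_cond_exp M (F n) (X (Suc n)) \<omega> + T \<omega>)"
    using iQ iT ce by simp
  also have "\<dots> \<le> expectation (\<lambda>\<omega>. H \<omega> * (compensated \<alpha> n \<omega> + ex n \<omega>))"
  proof (rule integral_mono_AE)
    show "integrable M (\<lambda>\<omega>. Q \<omega> * real_cond_exp M (F n) (X (Suc n)) \<omega> + T \<omega>)"
      using iT ce by simp
    show "AE \<omega> in M. Q \<omega> * real_cond_exp M (F n) (X (Suc n)) \<omega> + T \<omega>
        \<le> H \<omega> * (compensated \<alpha> n \<omega> + ex n \<omega>)"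
      using X_step[OF n] AE_space
    proof eventually_elim
      case (elim \<omega>)
      note \<omega> = elim(2)
      show ?case
      proof (cases "noise (Suc n) \<omega> < \<alpha>")
        case True
        let ?g = "growth n \<omega>" and ?g' = "growth (Suc n) \<omega>"
        have g: "1 \<le> ?g" "1 \<le> ?g'" using growth_ge_1[OF \<omega>] by auto
        have g': "?g' = ?g * (1 + chi n \<omega>)" by (simp add: growth_def)
        have JH: "J \<omega> = H \<omega>" using True by (simp add: J_def)
        have n': "noise n \<omega> < \<alpha>" "noise (Suc n) \<omega> = noise n \<omega> + eta n \<omega>"
          using True eta_nonneg[OF \<omega>, of n] by (auto simp: noise_def)
        have "Q \<omega> * real_cond_exp M (F n) (X (Suc n)) \<omega>
            \<le> Q \<omega> * ((1 + chi n \<omega>) * X n \<omega> + eta n \<omega> + ex n \<omega>)"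
          using elim(1) Q[OF \<omega>] by (intro mult_left_mono) auto
        also have "\<dots> = Q \<omega> * ((1 + chi n \<omega>) * X n \<omega>) + Q \<omega> * (eta n \<omega> + ex n \<omega>)"
          by (simp add: algebra_simps)
        also have "Q \<omega> * ((1 + chi n \<omega>) * X n \<omega>) = H \<omega> * (X n \<omega> / ?g)"
          using g chi_nonneg[OF \<omega>, of n] by (simp add: Q_def JH g')
        also have "Q \<omega> * (eta n \<omega> + ex n \<omega>) \<le> H \<omega> * (eta n \<omega> + ex n \<omega>)"
          using Q[OF \<omega>] eta_nonneg[OF \<omega>] ex_nonneg[OF \<omega>] by (intro mult_right_mono) auto
        finally show ?thesis
          using n' by (simp add: compensated_def T_def JH algebra_simps)
      next
        case False
        then show ?thesis
          using b[OF \<omega>] compensated_nonneg[OF \<omega>] ex_nonneg[OF \<omega>] by (simp add: Q_def T_def J_def)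
      qed
    qed
  qed (rule iR)
  finally show ?thesis .
qed

lemma compensated_almost_supermartingale:
  assumes "0 \<le> \<alpha>"
  shows "almost_supermartingale M F (compensated \<alpha>) ex N"
  by unfold_locales
    (auto intro: compensated_adapted compensated_nonneg compensated_int[OF assms] ex_nonneg ex_int
      compensated_step[OF assms])

text \<open>With \<open>Y = X / growth\<close>, the difference \<open>X i - X a\<close> equals
    \<open>growth i * (Y i - Y a) + (growth i - growth a) * Y a\<close>, and \<open>Y\<close> differs from the compensated process
    by the budget, which moves by at most \<open>\<delta>\<close>.\<close>

lemma oscillation_pathwise:
  assumes \<omega>: "\<omega> \<in> space M" and \<alpha>: "noise N \<omega> < \<alpha>" and L: "growth N \<omega> < L"
    and c: "\<And>i. i \<le> N \<Longrightarrow> compensated \<alpha> i \<omega> < c"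
    and ai: "a \<le> i" "i \<le> b" "b \<le> N"
    and osc: "\<bar>compensated \<alpha> i \<omega> - compensated \<alpha> a \<omega>\<bar> \<le> \<delta>"
    and nz: "noise b \<omega> - noise a \<omega> \<le> \<delta>" and gr: "growth b \<omega> - growth a \<omega> \<le> \<delta>'"
  shows "\<bar>X i \<omega> - X a \<omega>\<bar> \<le> 2 * L * \<delta> + \<delta>' * c"
proof -
  define Y where "Y k = X k \<omega> / growth k \<omega>" for k
  have g: "1 \<le> growth k \<omega>" for k by (rule growth_ge_1[OF \<omega>])
  have XY: "X k \<omega> = growth k \<omega> * Y k" for k using g[of k] by (simp add: Y_def)
  have Y0: "0 \<le> Y k" for k unfolding Y_def using X_nonneg[OF \<omega>, of k] g[of k] by simp
  have W: "compensated \<alpha> k \<omega> = Y k + (\<alpha> - noise k \<omega>)" if "k \<le> N" for k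
    using noise_mono[OF \<omega> that] \<alpha> by (simp add: compensated_def Y_def)
  have na: "noise a \<omega> \<le> noise i \<omega>" "noise i \<omega> \<le> noise b \<omega>" "noise a \<omega> \<le> noise N \<omega>"
    using ai by (auto intro!: noise_mono[OF \<omega>])
  have ga: "growth a \<omega> \<le> growth i \<omega>" "growth i \<omega> \<le> growth b \<omega>" "growth i \<omega> \<le> growth N \<omega>"
    using ai by (auto intro!: growth_mono[OF \<omega>])
  have d: "\<bar>Y i - Y a\<bar> \<le> 2 * \<delta>" using osc nz na W[of i] W[of a] ai by auto
  have Ya: "Y a \<le> c" using W[of a] c[of a] na \<alpha> ai by auto
  have "growth i \<omega> * \<bar>Y i - Y a\<bar> \<le> L * (2 * \<delta>)"
    using d ga L g[of i] by (intro mult_mono) auto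
  moreover have "(growth i \<omega> - growth a \<omega>) * Y a \<le> \<delta>' * c"
    using Y0 Ya ga gr by (intro mult_mono) auto
  moreover have "0 \<le> (growth i \<omega> - growth a \<omega>) * Y a" using ga Y0 by simp
  moreover have "X i \<omega> - X a \<omega> = growth i \<omega> * (Y i - Y a) + (growth i \<omega> - growth a \<omega>) * Y a"
    by (simp add: XY algebra_simps)
  moreover have "\<bar>growth i \<omega> * (Y i - Y a)\<bar> = growth i \<omega> * \<bar>Y i - Y a\<bar>"
    using g[of i] by (simp add: abs_mult)
  ultimately show ?thesis by (simp add: abs_le_iff) linarith
qed

text \<open>Off the events that \<open>noise\<close> reaches \<open>\<alpha>\<close>, that \<open>growth\<close> reaches \<open>L\<close> or that the compensated process
    reaches \<open>c\<close>, a large oscillation of \<open>X\<close> on an interval comes from an oscillation of the truncated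
    compensated process or from a large increment of \<open>noise\<close> or \<open>growth\<close> there. The three exceptional
    events have probability at most \<open>\<lambda> * (1/4 + 1/10 + 1/16) < \<lambda> / 2\<close> together. So every bad interval
    contributes at least \<open>\<lambda> / 2\<close> to the sums over all intervals of the probabilities of the other three
    events, and these sums are bounded by \<open>oscillation_sum\<close> and \<open>increment_count\<close>.\<close>

lemma bad_interval_count:
  fixes n :: "nat \<Rightarrow> nat"
  assumes \<alpha>: "0 < \<alpha>" and L: "1 \<le> L" and \<epsilon>: "0 < \<epsilon>" "\<epsilon> \<le> 1" and lam: "0 < lam"
    and \<kappa>: "expectation (X 0) + \<alpha> + 1 \<le> \<kappa>" and ex: "(\<Sum>i<N. expectation (ex i)) \<le> 1"
    and pn: "prob {\<omega> \<in> space M. \<alpha> \<le> noise N \<omega>} \<le> lam / 4"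
    and pg: "prob {\<omega> \<in> space M. L \<le> growth N \<omega>} \<le> lam / 10"
    and n: "n 0 = 0" "mono n" "n J \<le> N"
  shows "real (card {j. j < J \<and> lam \<le> prob {\<omega> \<in> space M.
           \<exists>i\<in>{n j..n (Suc j)}. \<exists>i'\<in>{n j..n (Suc j)}. \<epsilon> < \<bar>X i \<omega> - X i' \<omega>\<bar>}})
         * (lam\<^sup>2 * \<epsilon>\<^sup>2) \<le> 2 ^ 14 * \<kappa>\<^sup>2 * L\<^sup>2"
proof (cases "lam \<le> 1")
  case False
  then have "{j. j < J \<and> lam \<le> prob {\<omega> \<in> space M.
           \<exists>i\<in>{n j..n (Suc j)}. \<exists>i'\<in>{n j..n (Suc j)}. \<epsilon> < \<bar>X i \<omega> - X i' \<omega>\<bar>}} = {}"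
    using prob_le_1 by (smt (verit) empty_Collect_eq)
  then show ?thesis by (metis card.empty mult_eq_0_iff of_nat_0 zero_le_mult_iff zero_le_numeral zero_le_power zero_le_power2)
next
  case lam1: True
  interpret W: almost_supermartingale M F "compensated \<alpha>" ex N
    using \<alpha> by (intro compensated_almost_supermartingale) simp
  let ?W = "compensated \<alpha>"
  have EX0: "0 \<le> expectation (X 0)" using X_nonneg by (auto intro!: Bochner_Integration.integral_nonneg)
  have \<kappa>1: "1 \<le> \<kappa>" using EX0 \<kappa> \<alpha> by simp
  \<comment> \<open>By the maximal inequality the level \<open>c\<close> is reached with probability at most \<open>lam / 16\<close>. The
    thresholds \<open>\<delta>\<close> and \<open>\<delta>'\<close> make the bound \<open>2 * L * \<delta> + \<delta>' * c\<close> of \<open>oscillation_pathwise\<close> equal to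
    \<open>3 / 8 * \<epsilon>\<close>, so that two points of an interval differ by less than \<open>\<epsilon>\<close>.\<close>
  define c where "c = 16 * \<kappa> / lam"
  define \<delta> where "\<delta> = \<epsilon> / (8 * L)"
  define \<delta>' where "\<delta>' = \<epsilon> / (8 * c)"
  have c0: "0 < c" using \<kappa>1 lam by (simp add: c_def)
  have \<delta>0: "0 < \<delta>" "0 < \<delta>'" using \<epsilon> L c0 by (auto simp: \<delta>_def \<delta>'_def)
  have EW0: "expectation (?W 0) + 1 \<le> \<kappa>"
  proof -
    have "expectation (?W 0) \<le> expectation (\<lambda>\<omega>. X 0 \<omega> + \<alpha>)"
      using \<alpha> X_int by (intro integral_mono compensated_int compensated_le) auto
    also have "\<dots> = expectation (X 0) + \<alpha>" using X_int by (simp add: prob_space)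
    finally show ?thesis using \<kappa> by simp
  qed
  define A1 where "A1 = {\<omega> \<in> space M. \<alpha> \<le> noise N \<omega>}"
  define A2 where "A2 = {\<omega> \<in> space M. L \<le> growth N \<omega>}"
  define A3 where "A3 = {\<omega> \<in> space M. \<exists>i\<le>N. c \<le> ?W i \<omega>}"
  define B1 where "B1 j = {\<omega> \<in> space M. \<exists>i\<in>{n j..n (Suc j)}. \<delta> \<le> \<bar>W.gap c i \<omega> - W.gap c (n j) \<omega>\<bar>}" for j
  define B2 where "B2 j = {\<omega> \<in> space M. noise (n (Suc j)) \<omega> < \<alpha> \<and> \<delta> \<le> noise (n (Suc j)) \<omega> - noise (n j) \<omega>}" for j
  define B3 where "B3 j = {\<omega> \<in> space M. growth (n (Suc j)) \<omega> < L \<and> \<delta>' \<le> growth (n (Suc j)) \<omega> - growth (n j) \<omega>}" for j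
  define Bad where "Bad j = {\<omega> \<in> space M.
           \<exists>i\<in>{n j..n (Suc j)}. \<exists>i'\<in>{n j..n (Suc j)}. \<epsilon> < \<bar>X i \<omega> - X i' \<omega>\<bar>}" for j
  note noise_meas[measurable] growth_meas[measurable] W.gap_meas[measurable] W.W_meas[measurable]
  have meas[measurable]: "A1 \<in> sets M" "A2 \<in> sets M" "A3 \<in> sets M"
    "B1 j \<in> sets M" "B2 j \<in> sets M" "B3 j \<in> sets M" for j
    unfolding A1_def A2_def A3_def B1_def B2_def B3_def by measurable
  have nle: "n i \<le> n j" if "i \<le> j" for i j using n(2) that by (simp add: mono_def)
  have sub: "Bad j \<subseteq> A1 \<union> A2 \<union> A3 \<union> B1 j \<union> B2 j \<union> B3 j" if j: "j < J" for j
  proof (rule subsetI, rule ccontr)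
    fix \<omega> assume bad: "\<omega> \<in> Bad j" and "\<omega> \<notin> A1 \<union> A2 \<union> A3 \<union> B1 j \<union> B2 j \<union> B3 j"
    then have \<omega>: "\<omega> \<in> space M" and h: "\<omega> \<notin> A1" "\<omega> \<notin> A2" "\<omega> \<notin> A3" "\<omega> \<notin> B1 j" "\<omega> \<notin> B2 j" "\<omega> \<notin> B3 j"
      by (auto simp: Bad_def)
    have nN: "n (Suc j) \<le> N" using nle[of "Suc j" J] j n(3) by simp
    have a1: "noise N \<omega> < \<alpha>" and a2: "growth N \<omega> < L"
      using h \<omega> by (auto simp: A1_def A2_def not_le)
    have a3: "?W i \<omega> < c" if "i \<le> N" for i
    proof (rule ccontr)
      assume "\<not> ?W i \<omega> < c"
      then have "\<omega> \<in> A3" using \<omega> that by (auto simp: A3_def not_less)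
      then show False using h by simp
    qed
    have b2: "noise (n (Suc j)) \<omega> - noise (n j) \<omega> \<le> \<delta>"
      using h(5) \<omega> a1 noise_mono[OF \<omega> nN] by (auto simp: B2_def)
    have b3: "growth (n (Suc j)) \<omega> - growth (n j) \<omega> \<le> \<delta>'"
      using h(6) \<omega> a2 growth_mono[OF \<omega> nN] by (auto simp: B3_def)
    have near: "\<bar>X i \<omega> - X (n j) \<omega>\<bar> \<le> 3 / 8 * \<epsilon>" if i: "n j \<le> i" "i \<le> n (Suc j)" for i
    proof -
      have "\<bar>W.gap c i \<omega> - W.gap c (n j) \<omega>\<bar> < \<delta>"
        using h(4) \<omega> i by (auto simp: B1_def not_le)
      then have "\<bar>?W i \<omega> - ?W (n j) \<omega>\<bar> \<le> \<delta>"
        using a3[of i] a3[of "n j"] i nN by (auto simp: W.gap_def)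
      then have "\<bar>X i \<omega> - X (n j) \<omega>\<bar> \<le> 2 * L * \<delta> + \<delta>' * c"
        using a3 by (intro oscillation_pathwise[OF \<omega> a1 a2 _ i nN _ b2 b3])
      also have "\<dots> = 3 / 8 * \<epsilon>" using L c0 by (simp add: \<delta>_def \<delta>'_def)
      finally show ?thesis .
    qed
    obtain i i' where i: "n j \<le> i" "i \<le> n (Suc j)" and i': "n j \<le> i'" "i' \<le> n (Suc j)"
      and osc: "\<epsilon> < \<bar>X i \<omega> - X i' \<omega>\<bar>" using bad by (auto simp: Bad_def)
    show False using near[OF i] near[OF i'] osc \<epsilon> by linarith
  qed
  have pA3: "prob A3 \<le> lam / 16"
  proof -
    have "c * prob A3 \<le> \<kappa>"
      using W.maximal_inequality[of c] c0 EW0 ex by (simp add: A3_def)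
    then show ?thesis using \<kappa>1 lam by (simp add: c_def field_simps)
  qed
  have half: "lam / 2 \<le> prob (B1 j) + prob (B2 j) + prob (B3 j)" if "j < J" "lam \<le> prob (Bad j)" for j
  proof -
    have "prob (Bad j) \<le> prob (A1 \<union> A2 \<union> A3 \<union> B1 j \<union> B2 j \<union> B3 j)"
      using sub[OF that(1)] by (intro finite_measure_mono) measurable
    also have "\<dots> \<le> prob A1 + prob A2 + prob A3 + prob (B1 j) + prob (B2 j) + prob (B3 j)"
      by (intro order.trans[OF measure_Un_le] add_right_mono; (measurable)?)
    finally show ?thesis using that pn pg pA3 lam by (simp add: A1_def A2_def)
  qed
  define U where "U = \<kappa>\<^sup>2 * L\<^sup>2 / (lam * \<epsilon>\<^sup>2)"
  have S1: "(\<Sum>j<J. prob (B1 j)) \<le> 4096 * U"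
  proof -
    have "\<delta>\<^sup>2 * (\<Sum>j<J. prob (B1 j)) \<le> 2 * c * expectation (?W 0) + 4 * c * (\<Sum>i<N. expectation (ex i))"
      unfolding B1_def using c0 \<delta>0 n by (intro W.oscillation_sum) auto
    also have "\<dots> \<le> 4 * c * expectation (?W 0) + 4 * c * 1"
    proof (intro add_mono mult_left_mono)
      have "0 \<le> expectation (?W 0)"
        using compensated_nonneg by (auto intro!: Bochner_Integration.integral_nonneg)
      then show "2 * c * expectation (?W 0) \<le> 4 * c * expectation (?W 0)" using c0 by simp
    qed (use ex c0 in auto)
    also have "\<dots> \<le> 4 * c * \<kappa>"
      using mult_left_mono[OF EW0, of "4 * c"] c0 by (simp add: algebra_simps)
    finally have "(\<Sum>j<J. prob (B1 j)) \<le> 4 * c * \<kappa> / \<delta>\<^sup>2" using \<delta>0 by (simp add: field_simps)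
    also have "\<dots> = 4096 * U"
      using \<epsilon> L lam by (simp add: U_def c_def \<delta>_def field_simps power2_eq_square)
    finally show ?thesis .
  qed
  have \<kappa>L: "1 \<le> \<kappa> * L" using mult_mono[of 1 \<kappa> 1 L] \<kappa>1 L by simp
  then have \<kappa>L2: "\<kappa> * L \<le> (\<kappa> * L) * (\<kappa> * L)"
    using mult_left_mono[of 1 "\<kappa> * L" "\<kappa> * L"] by simp
  have S2: "(\<Sum>j<J. prob (B2 j)) \<le> 8 * U"
  proof -
    have "\<delta> * (\<Sum>j<J. prob (B2 j)) \<le> \<alpha>"
      unfolding B2_def using \<delta>0 \<alpha> nle noise_nonneg
      by (intro increment_count[where Y = "\<lambda>j. noise (n j)"]) (auto intro: noise_mono noise_meas)
    then have "(\<Sum>j<J. prob (B2 j)) \<le> \<alpha> * (8 * L) / \<epsilon>" using \<epsilon> L by (simp add: \<delta>_def field_simps)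
    also have "\<dots> \<le> \<kappa> * (8 * L) / \<epsilon>"
      using \<kappa> EX0 \<epsilon> L by (intro divide_right_mono mult_right_mono) auto
    also have "\<dots> \<le> (\<kappa> * (8 * L)) * (\<kappa> * L) / (lam * \<epsilon>\<^sup>2)"
    proof (rule frac_le)
      show "\<kappa> * (8 * L) \<le> (\<kappa> * (8 * L)) * (\<kappa> * L)"
        using \<kappa>L2 by (simp add: algebra_simps)
      have "lam * \<epsilon>\<^sup>2 \<le> 1 * \<epsilon>"
        using lam lam1 \<epsilon> by (intro mult_mono) (auto simp: power2_eq_square)
      then show "lam * \<epsilon>\<^sup>2 \<le> \<epsilon>" by simp
    qed (use \<kappa>1 L lam \<epsilon> in auto)
    also have "\<dots> = 8 * U" by (simp add: U_def power2_eq_square)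
    finally show ?thesis .
  qed
  have S3: "(\<Sum>j<J. prob (B3 j)) \<le> 128 * U"
  proof -
    have "\<delta>' * (\<Sum>j<J. prob (B3 j)) \<le> L"
      unfolding B3_def using \<delta>0 L nle order.trans[OF zero_le_one growth_ge_1]
      by (intro increment_count[where Y = "\<lambda>j. growth (n j)"]) (auto intro: growth_mono growth_meas)
    then have "(\<Sum>j<J. prob (B3 j)) \<le> L * (8 * c) / \<epsilon>" using \<epsilon> c0 by (simp add: \<delta>'_def field_simps)
    also have "\<dots> = 128 * (\<kappa> * L) / (lam * \<epsilon>)" by (simp add: c_def)
    also have "\<dots> \<le> 128 * (\<kappa> * L) * (\<kappa> * L) / (lam * \<epsilon>\<^sup>2)"
    proof (rule frac_le)
      show "128 * (\<kappa> * L) \<le> 128 * (\<kappa> * L) * (\<kappa> * L)" using \<kappa>L2 by (simp add: algebra_simps)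
      show "lam * \<epsilon>\<^sup>2 \<le> lam * \<epsilon>" using lam \<epsilon> by (simp add: power2_eq_square)
    qed (use \<kappa>1 L lam \<epsilon> in auto)
    also have "\<dots> = 128 * U" by (simp add: U_def power2_eq_square)
    finally show ?thesis .
  qed
  let ?C = "{j. j < J \<and> lam \<le> prob (Bad j)}"
  have "real (card ?C) * (lam / 2) = (\<Sum>j\<in>?C. lam / 2)" by simp
  also have "\<dots> \<le> (\<Sum>j\<in>?C. prob (B1 j) + prob (B2 j) + prob (B3 j))"
    by (rule sum_mono) (use half in auto)
  also have "\<dots> \<le> (\<Sum>j<J. prob (B1 j) + prob (B2 j) + prob (B3 j))"
    by (rule sum_mono2) auto
  also have "\<dots> \<le> 4232 * U" unfolding sum.distrib using S1 S2 S3 by linarith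
  finally have "real (card ?C) * (lam / 2) * (lam * \<epsilon>\<^sup>2) \<le> 4232 * U * (lam * \<epsilon>\<^sup>2)"
    using lam by (intro mult_right_mono) auto
  also have "\<dots> = 4232 * (\<kappa>\<^sup>2 * L\<^sup>2)" using lam \<epsilon> by (simp add: U_def)
  finally have "real (card ?C) * (lam\<^sup>2 * \<epsilon>\<^sup>2) \<le> 8464 * (\<kappa>\<^sup>2 * L\<^sup>2)" by (simp add: power2_eq_square)
  also have "\<dots> \<le> 2 ^ 14 * \<kappa>\<^sup>2 * L\<^sup>2" by simp
  finally show ?thesis by (simp add: Bad_def)
qed

end


section \<open>Infinite sums and products of random variables\<close>

text \<open>This form shows that an infinite product of random variables is measurable: where the product
    diverges, its value is the fixed default value of a definite description.\<close>

lemma prodinf_eq_if_convergent: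
  fixes f :: "nat \<Rightarrow> real"
  assumes "\<And>i. 1 \<le> f i"
  shows "prodinf f =
    (if convergent (\<lambda>n. \<Prod>i<n. f i) then lim (\<lambda>n. \<Prod>i<n. f i) else (THE p. False))"
proof (cases "convergent (\<lambda>n. \<Prod>i<n. f i)")
  case True
  then obtain l where l: "(\<lambda>n. \<Prod>i<n. f i) \<longlonglongrightarrow> l" by (auto simp: convergent_def)
  have "1 \<le> l"
    by (rule LIMSEQ_le_const[OF l]) (auto intro!: prod_ge_1 assms)
  then have "prodinf f = l" by (intro prodinf_eq_prod_lim'[OF l]) auto
  then show ?thesis using True limI[OF l] by simp
next
  case False
  have "\<not> f has_prod p" for p
  proof
    assume "f has_prod p"
    moreover have "p \<noteq> 0"
    proof -
      have "f i \<noteq> 0" for i using assms[of i] by linarith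
      then show ?thesis using has_prod_eq_0_iff[OF \<open>f has_prod p\<close>] by force
    qed
    ultimately have "(\<lambda>n. \<Prod>i\<le>n. f i) \<longlonglongrightarrow> p" by (intro has_prod_imp_tendsto)
    then show False using False LIMSEQ_lessThan_iff_atMost[of "prod f" p] by (auto simp: convergent_def)
  qed
  then show ?thesis using False by (simp add: prodinf_def)
qed

context prob_space
begin

lemma prob_partial_sum_le:
  fixes Y :: "nat \<Rightarrow> 'a \<Rightarrow> real"
  assumes Y[measurable]: "\<And>n. Y n \<in> borel_measurable M"
    and nn: "\<And>n \<omega>. \<omega> \<in> space M \<Longrightarrow> 0 \<le> Y n \<omega>"
    and s: "AE \<omega> in M. summable (\<lambda>n. Y n \<omega>)"
  shows "prob {\<omega> \<in> space M. c \<le> (\<Sum>i<N. Y i \<omega>)} \<le> prob {\<omega> \<in> space M. c \<le> (\<Sum>i. Y i \<omega>)}"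
proof (rule finite_measure_mono_AE)
  show "AE \<omega> in M. \<omega> \<in> {\<omega> \<in> space M. c \<le> (\<Sum>i<N. Y i \<omega>)} \<longrightarrow> \<omega> \<in> {\<omega> \<in> space M. c \<le> (\<Sum>i. Y i \<omega>)}"
    using s AE_space
  proof eventually_elim
    case (elim \<omega>)
    have "(\<Sum>i<N. Y i \<omega>) \<le> (\<Sum>i. Y i \<omega>)"
      by (rule sum_le_suminf[OF elim(1)]) (auto simp: nn elim)
    then show ?case by auto
  qed
  show "{\<omega> \<in> space M. c \<le> (\<Sum>i. Y i \<omega>)} \<in> sets M" by measurable
qed

lemma prob_partial_prod_le:
  fixes Y :: "nat \<Rightarrow> 'a \<Rightarrow> real"
  assumes Y[measurable]: "\<And>n. Y n \<in> borel_measurable M"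
    and nn: "\<And>n \<omega>. \<omega> \<in> space M \<Longrightarrow> 0 \<le> Y n \<omega>"
    and s: "AE \<omega> in M. summable (\<lambda>n. Y n \<omega>)"
  shows "prob {\<omega> \<in> space M. c \<le> (\<Prod>i<N. 1 + Y i \<omega>)} \<le> prob {\<omega> \<in> space M. c \<le> (\<Prod>i. 1 + Y i \<omega>)}"
proof (rule finite_measure_mono_AE)
  show "AE \<omega> in M. \<omega> \<in> {\<omega> \<in> space M. c \<le> (\<Prod>i<N. 1 + Y i \<omega>)} \<longrightarrow>
      \<omega> \<in> {\<omega> \<in> space M. c \<le> (\<Prod>i. 1 + Y i \<omega>)}"
    using s AE_space
  proof eventually_elim
    case (elim \<omega>)
    have n: "0 \<le> Y n \<omega>" for n using nn elim by auto
    have "Y n \<omega> \<noteq> -1" for n using n[of n] by linarith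
    then have "convergent_prod (\<lambda>i. 1 + Y i \<omega>)"
      using elim(1) n by (intro summable_imp_convergent_prod_real) auto
    then have "(\<lambda>i. 1 + Y i \<omega>) has_prod (\<Prod>i. 1 + Y i \<omega>)" by (rule convergent_prod_has_prod)
    then have "(\<Prod>i<N. 1 + Y i \<omega>) \<le> (\<Prod>i. 1 + Y i \<omega>)"
      using n by (intro prod_le_prodinf) (auto intro: add_nonneg_nonneg)
    then show ?case by auto
  qed
  have part: "(\<lambda>\<omega>. \<Prod>i<n. 1 + Y i \<omega>) \<in> borel_measurable M" for n by measurable
  note borel_measurable_lim_metric[OF part, measurable] sets_Collect_Cauchy[OF part, measurable]
  have "{\<omega> \<in> space M. c \<le> (if convergent (\<lambda>n. \<Prod>i<n. 1 + Y i \<omega>)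
      then lim (\<lambda>n. \<Prod>i<n. 1 + Y i \<omega>) else (THE p. False))} \<in> sets M"
    unfolding Cauchy_convergent_iff[symmetric] by measurable
  moreover have "(\<Prod>i. 1 + Y i \<omega>) = (if convergent (\<lambda>n. \<Prod>i<n. 1 + Y i \<omega>)
      then lim (\<lambda>n. \<Prod>i<n. 1 + Y i \<omega>) else (THE p. False))" if "\<omega> \<in> space M" for \<omega>
    using nn[OF that] by (intro prodinf_eq_if_convergent) simp
  ultimately show "{\<omega> \<in> space M. c \<le> (\<Prod>i. 1 + Y i \<omega>)} \<in> sets M"
    by (simp cong: conj_cong)
qed

end

section \<open>Positivity and size of the explicit bounds\<close>

lemma mu_min_le: "n \<le> N \<Longrightarrow> mu_min \<mu> N \<epsilon> \<le> \<mu> n \<epsilon>"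
  unfolding mu_min_def by (intro Min_le) (auto simp: setcompr_eq_image)

lemma mu_min_pos:
  assumes "\<And>n. 0 < \<mu> n \<epsilon>" shows "0 < mu_min \<mu> N \<epsilon>"
  unfolding mu_min_def using assms by (subst Min_gr_iff) (auto simp: setcompr_eq_image)

lemma rate_e_le: "N \<noteq> 0 \<Longrightarrow> rate_e f h K \<mu> lam \<epsilon> N \<le> \<epsilon> / (2 * real N)"
  by (simp add: rate_e_def)

lemma rate_p_le: "N \<noteq> 0 \<Longrightarrow> rate_p h \<mu> lam \<epsilon> N \<le> mu_min \<mu> N (\<epsilon> / (8 * (real N)\<^sup>2))"
  by (simp add: rate_p_def)

context
  fixes h :: "real \<Rightarrow> nat" and \<mu> :: "nat \<Rightarrow> real \<Rightarrow> real" and lam \<epsilon> :: real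
  assumes h: "1 \<le> h (lam / 10)" and \<epsilon>: "0 < \<epsilon>" and \<mu>: "\<And>n t. 0 < t \<Longrightarrow> 0 < \<mu> n t"
begin

lemma rate_eps0_lam0_pos:
  assumes "N \<noteq> 0"
  shows "0 < rate_eps0 h lam \<epsilon> N * rate_lam0 h \<mu> lam \<epsilon> N"
proof -
  have "0 < rate_lam0 h \<mu> lam \<epsilon> N"
  proof -
    let ?S = "{mu_min \<mu> e (\<epsilon>\<^sup>2 / (512 * (real e)\<^sup>2 * (real (h (lam / 10)))\<^sup>2)) | e. 1 \<le> e \<and> e \<le> N}"
    have S: "?S = (\<lambda>e. mu_min \<mu> e (\<epsilon>\<^sup>2 / (512 * (real e)\<^sup>2 * (real (h (lam / 10)))\<^sup>2))) ` {1..N}"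
      by auto
    have "finite ?S" "?S \<noteq> {}" unfolding S using assms by auto
    moreover have "0 < s" if "s \<in> ?S" for s
      using that h \<epsilon> by (auto intro!: mu_min_pos \<mu>)
    ultimately show ?thesis unfolding rate_lam0_def by (subst Min_gr_iff) auto
  qed
  moreover have "0 < rate_eps0 h lam \<epsilon> N" using assms h \<epsilon> by (simp add: rate_eps0_def)
  ultimately show ?thesis by simp
qed

lemma rate_p_pos: "0 < rate_p h \<mu> lam \<epsilon> N"
  using rate_eps0_lam0_pos[of N] \<epsilon> by (auto simp: rate_p_def intro!: mu_min_pos \<mu>)

lemma rate_e_pos:
  assumes "0 < lam" shows "0 < rate_e f h K \<mu> lam \<epsilon> N"
proof -
  have a: "0 \<le> rate_alpha f lam" by (simp add: rate_alpha_def)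
  have "1 \<le> rate_beta f K lam"
    unfolding rate_beta_def using a by (subst Max_ge_iff) auto
  then show ?thesis
    using rate_eps0_lam0_pos[of N] \<epsilon> assms a
    by (auto simp: rate_e_def intro!: mult_pos_pos)
qed

end

lemma least_index_less: "0 < s \<Longrightarrow> 1 / (real (least_index s) + 1) < s"
proof -
  assume "0 < s"
  then obtain r where "inverse (real (Suc r)) < s" using reals_Archimedean by blast
  then have "1 / (real r + 1) < s" by (simp add: inverse_eq_divide add.commute)
  then show ?thesis unfolding least_index_def by (rule LeastI)
qed

section \<open>The number of intervals of large fluctuation\<close>

context filtered_prob_space
begin

text \<open>The one-step inequality may fail on a rare event \<open>E m\<close>. There the conditional expectation itself
    is taken as excess. Its integral over \<open>E m\<close> is that of \<open>X (m+1)\<close>, and this is small by absolute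
    continuity, since \<open>rate_p\<close> lies below the relevant value of the modulus; the deterministic error
    is controlled by \<open>rate_e\<close>. The expected excess per step is at most \<open>1 / N\<close>, and
    \<open>bad_interval_count\<close> applies.\<close>

lemma fluctuation_count:
  fixes X chi eta :: "nat \<Rightarrow> 'w \<Rightarrow> real" and f h :: "real \<Rightarrow> nat" and n :: "nat \<Rightarrow> nat"
  assumes X: "\<And>n. X n \<in> borel_measurable (F n)" "\<And>n \<omega>. \<omega> \<in> space M \<Longrightarrow> 0 \<le> X n \<omega>"
    and acm: "\<And>n. absolute_continuity_modulus M (X n) (\<mu> n)"
    and eta: "eta \<in> l1_plus M F" and chi: "chi \<in> l1_plus M F"
    and h1: "1 \<le> h (lam / 10)"
    and f: "prob {\<omega> \<in> space M. real (f (lam / 4)) \<le> (\<Sum>i. eta i \<omega>)} < lam / 4"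
    and h: "prob {\<omega> \<in> space M. real (h (lam / 10)) \<le> (\<Prod>i. 1 + chi i \<omega>)} < lam / 10"
    and K: "expectation (X 0) < K"
    and lam: "0 < lam" and \<epsilon>: "0 < \<epsilon>" "\<epsilon> \<le> 1"
    and step: "\<And>m. m < N \<Longrightarrow> prob {\<omega> \<in> space M. real_cond_exp M (F m) (X (Suc m)) \<omega>
        > (1 + chi m \<omega>) * X m \<omega> + eta m \<omega> + 1 / (real r + 1)} < rate_p h \<mu> lam \<epsilon> N"
    and r: "1 / (real r + 1) < rate_e f h K \<mu> lam \<epsilon> N"
    and n: "n 0 = 0" "mono n" "n J \<le> N"
  shows "card {j. j < J \<and> lam \<le> prob {\<omega> \<in> space M.
           \<exists>i\<in>{n j..n (Suc j)}. \<exists>i'\<in>{n j..n (Suc j)}. \<epsilon> < \<bar>X i \<omega> - X i' \<omega>\<bar>}}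
         < rate_Z f h K lam \<epsilon>" (is "card ?C < _")
proof -
  let ?\<alpha> = "real (f (lam / 4))" and ?L = "real (h (lam / 10))"
  have X_int: "integrable M (X n)" for n using acm[of n] by (simp add: absolute_continuity_modulus_def)
  have EX: "0 \<le> expectation (X 0)" using X by (auto intro!: Bochner_Integration.integral_nonneg)
  define q where "q = 2 ^ 17 * (K + ?\<alpha> + 1)\<^sup>2 * ?L\<^sup>2 / (lam\<^sup>2 * \<epsilon>\<^sup>2)"
  have q: "0 < q" using EX K h1 lam \<epsilon> by (auto simp: q_def intro!: divide_pos_pos mult_pos_pos)
  have Z: "q < real (rate_Z f h K lam \<epsilon>)"
  proof -
    have "real (rate_Z f h K lam \<epsilon>) = 4 * real (nat \<lceil>q\<rceil>)"
      by (simp only: rate_Z_def q_def of_nat_mult of_nat_numeral)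
    moreover have "q \<le> real (nat \<lceil>q\<rceil>)" by (rule real_nat_ceiling_ge)
    ultimately show ?thesis using q by linarith
  qed
  have empty: ?thesis if "?C = {}"
  proof -
    have "real (card ?C) < real (rate_Z f h K lam \<epsilon>)"
      unfolding that using Z q by simp
    then show ?thesis by (simp only: of_nat_less_iff)
  qed
  show ?thesis
  proof (cases "N = 0 \<or> f (lam / 4) = 0")
    case True
    then show ?thesis
    \<comment> \<open>For \<open>N = 0\<close> all intervals consist of one point, and \<open>f (lam / 4) = 0\<close> forces \<open>lam > 1\<close>; in
      both cases no interval is bad.\<close>
    proof
      assume "N = 0"
      have "n j = 0" if "j \<le> J" for j
        using monoD[OF n(2) that] n(3) \<open>N = 0\<close> by simp
      then have "?C = {}" using lam \<epsilon> by auto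
      then show ?thesis by (rule empty)
    next
      assume f0: "f (lam / 4) = 0"
      have eta0: "\<And>i \<omega>. \<omega> \<in> space M \<Longrightarrow> 0 \<le> eta i \<omega>" "AE \<omega> in M. summable (\<lambda>i. eta i \<omega>)"
        and [measurable]: "eta i \<in> borel_measurable M" for i
        using eta measurable_F_M by (auto simp: l1_plus_def adapted_def)
      have "prob {\<omega> \<in> space M. 0 \<le> (\<Sum>i<0. eta i \<omega>)} \<le> prob {\<omega> \<in> space M. 0 \<le> (\<Sum>i. eta i \<omega>)}"
        by (rule prob_partial_sum_le) (use eta0 in auto)
      then have "1 < lam" using f f0 by (simp add: prob_space)
      then have "?C = {}" using prob_le_1 by (auto simp: not_le intro: le_less_trans)
      then show ?thesis by (rule empty)
    qed
  next
    case False
    define e where "e = 1 / (real r + 1)"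
    define ce where "ce m = real_cond_exp M (F m) (X (Suc m))" for m
    define E where "E m = {\<omega> \<in> space M. ce m \<omega> > (1 + chi m \<omega>) * X m \<omega> + eta m \<omega> + e}" for m
    define ex where "ex m = (\<lambda>\<omega>. e + indicat_real (E m) \<omega> * ce m \<omega>)" for m
    have e0: "0 < e" by (simp add: e_def)
    have N: "N \<noteq> 0" using False by simp
    have adp: "chi m \<in> borel_measurable (F m)" "eta m \<in> borel_measurable (F m)" for m
      using chi eta by (auto simp: l1_plus_def adapted_def)
    have nn: "0 \<le> chi m \<omega>" "0 \<le> eta m \<omega>" if "\<omega> \<in> space M" for m \<omega>
      using chi eta that by (auto simp: l1_plus_def)
    have sm: "AE \<omega> in M. summable (\<lambda>i. chi i \<omega>)" "AE \<omega> in M. summable (\<lambda>i. eta i \<omega>)"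
      using chi eta by (auto simp: l1_plus_def)
    have EF: "E m \<in> sets (F m)" for m
    proof -
      note adp[measurable] X(1)[measurable]
      have [measurable]: "ce m \<in> borel_measurable (F m)" unfolding ce_def by simp
      have "{\<omega> \<in> space (F m). ce m \<omega> > (1 + chi m \<omega>) * X m \<omega> + eta m \<omega> + e} \<in> sets (F m)"
        by measurable
      then show ?thesis by (simp add: E_def)
    qed
    have ce_pos: "0 \<le> indicat_real (E m) \<omega> * ce m \<omega>" if "\<omega> \<in> space M" for m \<omega>
    proof -
      have "0 \<le> (1 + chi m \<omega>) * X m \<omega> + eta m \<omega> + e"
        using nn[OF that] X(2)[OF that] e0 by (intro add_nonneg_nonneg mult_nonneg_nonneg) auto
      then show ?thesis by (auto simp: E_def indicator_def)
    qed
    have iE: "integrable M (\<lambda>\<omega>. indicat_real (E m) \<omega> * X (Suc m) \<omega>)" for m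
      using sets_F_M[OF EF] by (intro integrable_bounded_mult[where B = 1] X_int) (auto simp: indicator_def)
    have ceE: "integrable M (\<lambda>\<omega>. indicat_real (E m) \<omega> * ce m \<omega>)"
      "expectation (\<lambda>\<omega>. indicat_real (E m) \<omega> * ce m \<omega>) = expectation (\<lambda>\<omega>. indicat_real (E m) \<omega> * X (Suc m) \<omega>)" for m
    proof -
      interpret fm: finite_measure_subalgebra M "F m"
        by unfold_locales (rule subalg)
      show "integrable M (\<lambda>\<omega>. indicat_real (E m) \<omega> * ce m \<omega>)"
        "expectation (\<lambda>\<omega>. indicat_real (E m) \<omega> * ce m \<omega>) = expectation (\<lambda>\<omega>. indicat_real (E m) \<omega> * X (Suc m) \<omega>)"
        using fm.real_cond_exp_intg[OF iE borel_measurable_indicator[OF EF] measurable_F_M[OF X(1)]]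
        by (auto simp: ce_def)
    qed
    have ex_int: "integrable M (ex m)" for m using ceE unfolding ex_def by simp
    have Eex: "expectation (ex m) \<le> 1 / real N" if m: "m < N" for m
    proof -
      let ?t = "\<epsilon> / (8 * (real N)\<^sup>2)"
      have "prob (E m) < rate_p h \<mu> lam \<epsilon> N" using step[OF m] by (simp add: E_def ce_def e_def)
      also have "\<dots> \<le> \<mu> (Suc m) ?t"
        using rate_p_le[OF N] mu_min_le[of "Suc m" N \<mu> ?t] m by (meson Suc_leI order_trans)
      finally have "(\<integral>\<omega>. \<bar>X (Suc m) \<omega>\<bar> * indicator (E m) \<omega> \<partial>M) \<le> ?t"
        using acm[of "Suc m"] sets_F_M[OF EF] \<epsilon> N by (simp add: absolute_continuity_modulus_def)
      also have "(\<integral>\<omega>. \<bar>X (Suc m) \<omega>\<bar> * indicator (E m) \<omega> \<partial>M)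
          = expectation (\<lambda>\<omega>. indicat_real (E m) \<omega> * X (Suc m) \<omega>)"
        by (intro Bochner_Integration.integral_cong) (auto simp: X)
      finally have "expectation (ex m) \<le> e + ?t"
        using ceE by (simp add: ex_def prob_space)
      also have "e \<le> \<epsilon> / (2 * real N)"
        using r rate_e_le[OF N, of f h K \<mu> lam \<epsilon>] by (simp add: e_def)
      also have "\<epsilon> / (2 * real N) \<le> 1 / (2 * real N)" using \<epsilon> by (intro divide_right_mono) auto
      also have "?t \<le> 1 / (2 * real N)"
        using \<epsilon> N by (intro frac_le) (auto simp: power2_eq_square)
      finally show ?thesis using N by (simp add: field_simps)
    qed
    interpret Q: quasi_supermartingale M F X chi eta ex N
    proof
      show "0 \<le> ex m \<omega>" if "\<omega> \<in> space M" for m \<omega>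
        using ce_pos[OF that, of m] e0 by (simp add: ex_def)
      show "AE \<omega> in M. real_cond_exp M (F m) (X (Suc m)) \<omega>
          \<le> (1 + chi m \<omega>) * X m \<omega> + eta m \<omega> + ex m \<omega>" if "m < N" for m
        using AE_space
      proof eventually_elim
        case (elim \<omega>)
        have "0 \<le> (1 + chi m \<omega>) * X m \<omega> + eta m \<omega> + e"
          using nn[OF elim] X(2)[OF elim] e0 by (intro add_nonneg_nonneg mult_nonneg_nonneg) auto
        then show ?case
          using nn[OF elim, of m] X(2)[OF elim, of m] e0 elim
          by (cases "\<omega> \<in> E m") (auto simp: ex_def E_def ce_def not_less)
      qed
    qed (use X X_int adp nn ex_int in auto)
    have "real (card ?C) * (lam\<^sup>2 * \<epsilon>\<^sup>2) \<le> 2 ^ 14 * (K + ?\<alpha> + 1)\<^sup>2 * ?L\<^sup>2"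
    proof (rule Q.bad_interval_count)
      show "0 < ?\<alpha>" using False by simp
      show "1 \<le> ?L" using h1 by simp
      show "expectation (X 0) + ?\<alpha> + 1 \<le> K + ?\<alpha> + 1" using K by simp
      have "(\<Sum>i<N. expectation (ex i)) \<le> (\<Sum>i<N. 1 / real N)"
        by (rule sum_mono) (use Eex in auto)
      then show "(\<Sum>i<N. expectation (ex i)) \<le> 1" using N by simp
      have "prob {\<omega> \<in> space M. ?\<alpha> \<le> Q.noise N \<omega>} \<le> prob {\<omega> \<in> space M. ?\<alpha> \<le> (\<Sum>i. eta i \<omega>)}"
        unfolding Q.noise_def using sm nn measurable_F_M[OF adp(2)] by (intro prob_partial_sum_le) auto
      then show "prob {\<omega> \<in> space M. ?\<alpha> \<le> Q.noise N \<omega>} \<le> lam / 4" using f by simp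
      have "prob {\<omega> \<in> space M. ?L \<le> Q.growth N \<omega>} \<le> prob {\<omega> \<in> space M. ?L \<le> (\<Prod>i. 1 + chi i \<omega>)}"
        unfolding Q.growth_def using sm nn measurable_F_M[OF adp(1)] by (intro prob_partial_prod_le) auto
      then show "prob {\<omega> \<in> space M. ?L \<le> Q.growth N \<omega>} \<le> lam / 10" using h by simp
    qed (use \<epsilon> lam n in auto)
    also have "\<dots> \<le> 2 ^ 17 * (K + ?\<alpha> + 1)\<^sup>2 * ?L\<^sup>2" by (intro mult_right_mono) auto
    also have "\<dots> = q * (lam\<^sup>2 * \<epsilon>\<^sup>2)" using lam \<epsilon> by (simp add: q_def)
    finally have "real (card ?C) \<le> q" using lam \<epsilon> by simp
    then show ?thesis using Z by simp
  qed
qed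

end


section \<open>Finite nets from a modulus of total boundedness\<close>

lemma separated_card_le:
  assumes "total_boundedness_modulus X \<gamma>" "S \<subseteq> X" "finite S"
    and sep: "\<And>s t. s \<in> S \<Longrightarrow> t \<in> S \<Longrightarrow> s \<noteq> t \<Longrightarrow> 1 / (real k + 1) < dist s t"
  shows "card S \<le> \<gamma> k"
proof (rule ccontr)
  assume c: "\<not> card S \<le> \<gamma> k"
  obtain e where e: "bij_betw e {..<card S} S"
    using ex_bij_betw_nat_finite[OF \<open>finite S\<close>] by (auto simp: atLeast0LessThan)
  define y where "y i = (if i < card S then e i else e 0)" for i
  have "range y \<subseteq> S" using c e by (auto simp: y_def bij_betw_def)
  then have "range y \<subseteq> X" using assms(2) by auto
  then obtain i j where ij: "i < j" "j \<le> \<gamma> k" "dist (y i) (y j) \<le> 1 / (real k + 1)"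
    using assms(1) unfolding total_boundedness_modulus_def by blast
  then have lt: "i < card S" "j < card S" using c by auto
  then have "e i \<noteq> e j" using e ij by (auto simp: bij_betw_def inj_on_def)
  moreover have "e i \<in> S" "e j \<in> S" using e lt by (auto simp: bij_betw_def)
  ultimately show False using sep[of "e i" "e j"] ij lt by (simp add: y_def)
qed

text \<open>A separated subset of maximal size is a net.\<close>

lemma finite_net:
  assumes "total_boundedness_modulus X \<gamma>" "A \<subseteq> X"
  obtains S where "finite S" "S \<subseteq> A" "card S \<le> \<gamma> k"
    "\<And>z. z \<in> A \<Longrightarrow> \<exists>s\<in>S. dist z s \<le> 1 / (real k + 1)"
proof -
  define sep where "sep S \<longleftrightarrow> finite S \<and> S \<subseteq> A \<and>
    (\<forall>s\<in>S. \<forall>t\<in>S. s \<noteq> t \<longrightarrow> 1 / (real k + 1) < dist s t)" for S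
  have bound: "card S \<le> \<gamma> k" if "sep S" for S
    using that assms by (intro separated_card_le[OF assms(1)]) (auto simp: sep_def)
  have "sep {}" by (simp add: sep_def)
  then have "\<exists>S. sep S \<and> (\<forall>T. sep T \<longrightarrow> card T \<le> card S)"
    by (rule ex_has_greatest_nat[of _ _ _ "Suc (\<gamma> k)"]) (use bound in \<open>simp add: less_Suc_eq_le\<close>)
  then obtain S where S: "sep S" "\<And>T. sep T \<Longrightarrow> card T \<le> card S" by auto
  show ?thesis
  proof (rule that)
    show "finite S" "S \<subseteq> A" using S(1) by (simp_all add: sep_def)
    show "card S \<le> \<gamma> k" using S(1) by (rule bound)
    fix z assume z: "z \<in> A"
    show "\<exists>s\<in>S. dist z s \<le> 1 / (real k + 1)"
    proof (rule ccontr)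
      assume "\<not> ?thesis"
      then have far: "1 / (real k + 1) < dist z s" if "s \<in> S" for s using that not_le by blast
      have "z \<notin> S"
      proof
        assume "z \<in> S"
        then have "1 / (real k + 1) < 0" using far[of z] by simp
        then show False by (simp add: divide_less_0_iff)
      qed
      moreover have "sep (insert z S)"
        unfolding sep_def
      proof (intro conjI ballI impI)
        fix s t assume "s \<in> insert z S" "t \<in> insert z S" "s \<noteq> t"
        then consider "s = z" "t \<in> S" | "t = z" "s \<in> S" | "s \<in> S" "t \<in> S" by blast
        then show "1 / (real k + 1) < dist s t"
        proof cases
          case 2
          then show ?thesis using far[of s] by (metis dist_commute)
        qed (use far S(1) \<open>s \<noteq> t\<close> in \<open>simp_all add: sep_def\<close>)
      qed (use S(1) z in \<open>simp_all add: sep_def\<close>)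
      ultimately show False using S(2)[of "insert z S"] S(1) by (simp add: sep_def)
    qed
  qed
qed

lemma total_boundedness_modulus_pos:
  assumes "total_boundedness_modulus X \<gamma>" "z \<in> X" shows "0 < \<gamma> k"
proof -
  have "range (\<lambda>_::nat. z) \<subseteq> X" using assms(2) by auto
  then obtain i j :: nat where "i < j" "j \<le> \<gamma> k"
    using assms(1) unfolding total_boundedness_modulus_def by blast
  then show ?thesis by simp
qed

section \<open>Stochastic quasi-Fejer monotone sequences\<close>

locale quasi_fejer = filtered_prob_space M F
  for M :: "'w measure" and F :: "nat \<Rightarrow> 'w measure" +
  fixes pt :: "'x::metric_space" and X0 :: "'x set" and AF :: "nat \<Rightarrow> 'x set"
    and G :: "real \<Rightarrow> real" and \<iota> :: "real \<Rightarrow> nat \<Rightarrow> nat" and \<nu> \<gamma> :: "nat \<Rightarrow> nat"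
    and D b0 :: real and x :: "nat \<Rightarrow> 'w \<Rightarrow> 'x" and eta chi :: "nat \<Rightarrow> 'w \<Rightarrow> real"
    and f h b :: "real \<Rightarrow> nat" and \<zeta> \<Phi> :: "real \<Rightarrow> nat \<Rightarrow> nat \<Rightarrow> nat"
    and \<mu> :: "nat \<Rightarrow> real \<Rightarrow> real"
  assumes AF_Inter: "(\<Inter>k. AF k) \<noteq> {}"
    and AF_borel: "\<And>k. AF k \<in> sets borel"
    and AF_Suc: "\<And>k. AF (Suc k) \<subseteq> AF k" and AF_X0: "\<And>k. AF k \<subseteq> X0"
    and G_fun: "G \<in> {0..} \<rightarrow> {0..}" and G_strict_mono: "strict_mono_on {0..} G"
    and G_cont: "continuous_on {0..} G" and G_0: "G 0 = 0"
    and G_uniform: "uniform_continuity_modulus G \<iota>"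
    and G_inverse: "inverse_continuity_modulus G \<nu>"
    and X0_tb: "total_boundedness_modulus X0 \<gamma>"
    and X0_bound: "\<And>z. z \<in> X0 \<Longrightarrow> dist z pt \<le> D"
    and x_adapted: "adapted F x"
    and eta: "eta \<in> l1_plus M F" and chi: "chi \<in> l1_plus M F"
    and h_ge_1: "\<And>lam. lam > 0 \<Longrightarrow> h lam \<ge> 1"
    and f_bound: "\<And>lam. lam > 0 \<Longrightarrow> \<P>(\<omega> in M. (\<Sum>i. eta i \<omega>) \<ge> real (f lam)) < lam"
    and h_bound: "\<And>lam. lam > 0 \<Longrightarrow> \<P>(\<omega> in M. (\<Prod>i. 1 + chi i \<omega>) \<ge> real (h lam)) < lam"
    and fejer: "\<And>lam r n z m. lam > 0 \<Longrightarrow> z \<in> AF (\<zeta> lam r n) \<Longrightarrow> m \<le> n \<Longrightarrow>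
           \<P>(\<omega> in M. real_cond_exp M (F m) (\<lambda>\<omega>. G (dist (x (m + 1) \<omega>) z)) \<omega>
                 > (1 + chi m \<omega>) * G (dist (x m \<omega>) z) + eta m \<omega> + 1 / (real r + 1)) < lam"
    and approx: "\<And>lam k N. lam > 0 \<Longrightarrow> \<P>(\<omega> in M. \<forall>n\<in>{N..\<Phi> lam k N}. x n \<omega> \<notin> AF k) < lam"
    and bounded: "\<And>lam. lam > 0 \<Longrightarrow> \<P>(\<omega> in M. \<exists>n. dist (x n \<omega>) pt > real (b lam)) < lam"
    and b0_int: "integrable M (\<lambda>\<omega>. G (dist (x 0 \<omega>) pt + D))"
    and b0: "b0 > expectation (\<lambda>\<omega>. G (dist (x 0 \<omega>) pt + D))"
    and acm: "\<And>n z. z \<in> X0 \<Longrightarrow> absolute_continuity_modulus M (\<lambda>\<omega>. G (dist (x n \<omega>) z)) (\<mu> n)"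
begin

lemma AF_antimono: "m \<le> n \<Longrightarrow> AF n \<subseteq> AF m"
  by (rule lift_Suc_antimono_le[of AF]) (auto intro: AF_Suc[THEN subsetD])

lemma X0_nonempty: obtains z where "z \<in> X0"
  using AF_Inter AF_X0[of 0] by auto

lemma \<gamma>_pos: "0 < \<gamma> k"
proof -
  obtain z where "z \<in> X0" by (rule X0_nonempty)
  then show ?thesis by (rule total_boundedness_modulus_pos[OF X0_tb])
qed

lemma \<mu>_pos: "0 < t \<Longrightarrow> 0 < \<mu> n t"
proof -
  assume t: "0 < t"
  obtain z where "z \<in> X0" by (rule X0_nonempty)
  then show ?thesis using acm[of z n] t by (simp add: absolute_continuity_modulus_def)
qed

lemma G_nonneg: "0 \<le> s \<Longrightarrow> 0 \<le> G s"
  using G_fun by auto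

lemma G_mono: "0 \<le> s \<Longrightarrow> s \<le> t \<Longrightarrow> G s \<le> G t"
  using G_strict_mono by (auto simp: strict_mono_on_def le_less)

text \<open>For \<open>c = 0\<close>, where the modulus says nothing, both arguments vanish.\<close>

lemma G_uniform_le:
  assumes "s \<in> {0..c}" "t \<in> {0..c}" "\<bar>s - t\<bar> \<le> 1 / (real (\<iota> c k) + 1)"
  shows "\<bar>G s - G t\<bar> \<le> 1 / (real k + 1)"
proof (cases "c > 0")
  case True
  then show ?thesis using assms G_uniform by (simp add: uniform_continuity_modulus_def)
next
  case False
  then have "s = 0" "t = 0" using assms by auto
  then show ?thesis by simp
qed

lemma x_meas: "x n \<in> F n \<rightarrow>\<^sub>M borel" "x n \<in> M \<rightarrow>\<^sub>M borel"
  using x_adapted measurable_F_M by (auto simp: adapted_def)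

lemma G_dist_adapted: "(\<lambda>\<omega>. G (dist (x n \<omega>) z)) \<in> borel_measurable (F n)"
proof -
  have "continuous_on UNIV (\<lambda>y. G (dist y z))"
    by (rule continuous_on_compose2[OF G_cont]) (auto intro: continuous_intros)
  then have "(\<lambda>y. G (dist y z)) \<in> borel_measurable borel" by (rule borel_measurable_continuous_onI)
  then show ?thesis using x_meas(1) by (rule measurable_compose[rotated])
qed

lemma dist_meas: "(\<lambda>\<omega>. dist (x n \<omega>) z) \<in> borel_measurable M"
proof -
  have "(\<lambda>y. dist y z) \<in> borel_measurable borel"
    by (rule borel_measurable_continuous_onI) (auto intro: continuous_intros)
  then show ?thesis using x_meas(2) by (rule measurable_compose[rotated])
qed

lemma G_dist_meas: "(\<lambda>\<omega>. G (dist (x n \<omega>) z)) \<in> borel_measurable M"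
  by (rule measurable_F_M[OF G_dist_adapted])

definition oscillation :: "real \<Rightarrow> nat \<Rightarrow> nat \<Rightarrow> 'x \<Rightarrow> 'w set" where
  "oscillation \<epsilon> m m' z = {\<omega> \<in> space M. \<exists>i\<in>{m..m'}. \<exists>i'\<in>{m..m'}.
     \<epsilon> < \<bar>G (dist (x i \<omega>) z) - G (dist (x i' \<omega>) z)\<bar>}"

lemma oscillation_sets: "oscillation \<epsilon> m m' z \<in> sets M"
proof -
  note G_dist_meas[measurable]
  show ?thesis unfolding oscillation_def by measurable
qed

lemma point_fluctuation_count:
  fixes n :: "nat \<Rightarrow> nat"
  assumes lam: "0 < lam" and \<epsilon>: "0 < \<epsilon>" "\<epsilon> \<le> 1"
    and z: "z \<in> AF (\<zeta> (rate_p h \<mu> lam \<epsilon> N) (least_index (rate_e f h b0 \<mu> lam \<epsilon> N)) N)"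
    and n: "n 0 = 0" "mono n" "n J \<le> N"
  shows "card {j. j < J \<and> lam \<le> prob (oscillation \<epsilon> (n j) (n (Suc j)) z)} < rate_Z f h b0 lam \<epsilon>"
  unfolding oscillation_def
proof (rule fluctuation_count)
  have zX: "z \<in> X0" using z AF_X0 by auto
  show "(\<lambda>\<omega>. G (dist (x n \<omega>) z)) \<in> borel_measurable (F n)" for n by (rule G_dist_adapted)
  show "0 \<le> G (dist (x n \<omega>) z)" for n \<omega> by (rule G_nonneg) simp
  show "absolute_continuity_modulus M (\<lambda>\<omega>. G (dist (x n \<omega>) z)) (\<mu> n)" for n
    by (rule acm[OF zX])
  then have int: "integrable M (\<lambda>\<omega>. G (dist (x n \<omega>) z))" for n
    by (simp add: absolute_continuity_modulus_def)
  have "expectation (\<lambda>\<omega>. G (dist (x 0 \<omega>) z)) \<le> expectation (\<lambda>\<omega>. G (dist (x 0 \<omega>) pt + D))"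
  proof (rule integral_mono[OF int b0_int])
    fix \<omega>
    have "dist (x 0 \<omega>) z \<le> dist (x 0 \<omega>) pt + dist z pt" by (rule dist_triangle2)
    then show "G (dist (x 0 \<omega>) z) \<le> G (dist (x 0 \<omega>) pt + D)"
      using X0_bound[OF zX] by (intro G_mono) auto
  qed
  then show "expectation (\<lambda>\<omega>. G (dist (x 0 \<omega>) z)) < b0" using b0 by simp
  have h1: "1 \<le> h (lam / 10)" using lam by (intro h_ge_1) simp
  then show "1 \<le> h (lam / 10)" .
  show "prob {\<omega> \<in> space M. real (f (lam / 4)) \<le> (\<Sum>i. eta i \<omega>)} < lam / 4"
    "prob {\<omega> \<in> space M. real (h (lam / 10)) \<le> (\<Prod>i. 1 + chi i \<omega>)} < lam / 10"
    using f_bound[of "lam / 4"] h_bound[of "lam / 10"] lam by auto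
  show "1 / (real (least_index (rate_e f h b0 \<mu> lam \<epsilon> N)) + 1) < rate_e f h b0 \<mu> lam \<epsilon> N"
    by (intro least_index_less rate_e_pos h1 \<epsilon> \<mu>_pos lam)
  have p: "0 < rate_p h \<mu> lam \<epsilon> N" by (intro rate_p_pos h1 \<epsilon> \<mu>_pos)
  show "prob {\<omega> \<in> space M. real_cond_exp M (F m) (\<lambda>\<omega>. G (dist (x (Suc m) \<omega>) z)) \<omega>
      > (1 + chi m \<omega>) * G (dist (x m \<omega>) z) + eta m \<omega>
        + 1 / (real (least_index (rate_e f h b0 \<mu> lam \<epsilon> N)) + 1)} < rate_p h \<mu> lam \<epsilon> N" if "m < N" for m
    using fejer[OF p z, of m] that by simp
qed (use assms eta chi in auto)

text \<open>The pigeonhole principle: each of at most \<open>q\<close> points spoils fewer than \<open>rate_Z\<close> of the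
    \<open>q * rate_Z\<close> consecutive intervals, so some interval is spoilt by none of them.\<close>

lemma stable_interval:
  assumes lam: "0 < lam" and \<epsilon>: "0 < \<epsilon>" "\<epsilon> \<le> 1"
    and N: "N = ((\<lambda>n. n + g n) ^^ (q * rate_Z f h b0 lam \<epsilon>)) 0"
    and S: "finite S" "card S \<le> q" "0 < q"
    and SA: "S \<subseteq> AF (\<zeta> (rate_p h \<mu> lam \<epsilon> N) (least_index (rate_e f h b0 \<mu> lam \<epsilon> N)) N)"
  shows "\<exists>m\<le>N. \<forall>z\<in>S. prob (oscillation \<epsilon> m (m + g m) z) < lam"
proof -
  let ?Z = "rate_Z f h b0 lam \<epsilon>"
  define n where "n j = ((\<lambda>n. n + g n) ^^ j) 0" for j
  have n: "n 0 = 0" "n (Suc j) = n j + g (n j)" for j by (auto simp: n_def)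
  have mono: "mono n" by (rule mono_iff_le_Suc[THEN iffD2]) (simp add: n)
  have nN: "n (q * ?Z) = N" by (simp add: n_def N)
  define C where "C z = {j. j < q * ?Z \<and> lam \<le> prob (oscillation \<epsilon> (n j) (n (Suc j)) z)}" for z
  have cC: "card (C z) < ?Z" if "z \<in> S" for z
    unfolding C_def using that SA mono nN n(1) by (intro point_fluctuation_count lam \<epsilon>) auto
  have fin: "finite (C z)" for z by (simp add: C_def)
  have "card (\<Union>z\<in>S. C z) < q * ?Z"
  proof (cases "S = {}")
    case True
    obtain w where w: "w \<in> AF (\<zeta> (rate_p h \<mu> lam \<epsilon> N) (least_index (rate_e f h b0 \<mu> lam \<epsilon> N)) N)"
      using AF_Inter by blast
    have "card (C w) < ?Z" unfolding C_def using w mono nN n(1) by (intro point_fluctuation_count lam \<epsilon>) auto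
    then show ?thesis using True S by simp
  next
    case False
    have "card (\<Union>z\<in>S. C z) \<le> (\<Sum>z\<in>S. card (C z))" using S(1) by (rule card_UN_le)
    also have "\<dots> < (\<Sum>z\<in>S. ?Z)" using S(1) False cC by (intro sum_strict_mono) auto
    also have "\<dots> \<le> q * ?Z" using S(2) by simp
    finally show ?thesis .
  qed
  then have "\<not> {..<q * ?Z} \<subseteq> (\<Union>z\<in>S. C z)"
    using card_mono[of "\<Union>z\<in>S. C z" "{..<q * ?Z}"] S(1) fin by auto
  then obtain j where j: "j < q * ?Z" "\<And>z. z \<in> S \<Longrightarrow> j \<notin> C z" by blast
  have "n j \<le> N" using monoD[OF mono, of j "q * ?Z"] j(1) nN by simp
  moreover have "\<forall>z\<in>S. prob (oscillation \<epsilon> (n j) (n j + g (n j)) z) < lam"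
    using j by (auto simp: C_def n not_le)
  ultimately show ?thesis by blast
qed

text \<open>Passing from \<open>z\<close> to a point \<open>s\<close> of the net and back costs one application of the modulus of
    uniform continuity at either end.\<close>

lemma oscillation_net:
  assumes \<omega>: "\<omega> \<in> space M" and bd: "\<And>n. dist (x n \<omega>) pt + D \<le> c"
    and z: "z \<in> X0" "s \<in> X0" "dist z s \<le> 1 / (real (\<iota> c l) + 1)"
    and osc: "\<omega> \<notin> oscillation \<epsilon> m m' s" and i: "i \<in> {m..m'}" "i' \<in> {m..m'}"
  shows "\<bar>G (dist (x i \<omega>) z) - G (dist (x i' \<omega>) z)\<bar> \<le> \<epsilon> + 2 / (real l + 1)"
proof -
  have in_c: "dist (x n \<omega>) w \<in> {0..c}" if "w \<in> X0" for n w
  proof -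
    have "dist (x n \<omega>) w \<le> dist (x n \<omega>) pt + dist w pt" by (rule dist_triangle2)
    then show ?thesis using bd[of n] X0_bound[OF that] by simp
  qed
  have near: "\<bar>G (dist (x n \<omega>) z) - G (dist (x n \<omega>) s)\<bar> \<le> 1 / (real l + 1)" for n
  proof (rule G_uniform_le[OF in_c in_c])
    have "\<bar>dist (x n \<omega>) z - dist (x n \<omega>) s\<bar> \<le> dist z s"
      using abs_dist_diff_le[of z "x n \<omega>" s] by (simp add: dist_commute)
    then show "\<bar>dist (x n \<omega>) z - dist (x n \<omega>) s\<bar> \<le> 1 / (real (\<iota> c l) + 1)" using z by simp
  qed (use z in auto)
  have "\<bar>G (dist (x i \<omega>) s) - G (dist (x i' \<omega>) s)\<bar> \<le> \<epsilon>"
    using osc \<omega> i by (force simp: oscillation_def not_less)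
  moreover have "2 / (real l + 1) = 1 / (real l + 1) + 1 / (real l + 1)" by simp
  ultimately show ?thesis using near[of i] near[of i'] by linarith
qed

text \<open>There are two nets to choose from. The probability \<open>lam_star\<close> granted to a single point is fitted to
    the size \<open>q1\<close> of a net for the accuracy \<open>3 * K + 2\<close>, whereas the number of intervals available in
    \<open>Psi\<close> is fitted to the size \<open>q\<close> of a net for the accuracy \<open>6 * \<nu> (2 * k + 1) + 5\<close>. As the moduli are
    not assumed to be monotone, \<open>q1\<close> and \<open>q\<close> may be ordered either way. The smaller of the two nets has at
    most \<open>q\<close> points, hence a common stable interval, and at most \<open>q1\<close> points, hence a total error
    probability of at most \<open>lh / 2\<close>. For \<open>K \<ge> 6 * \<nu> (2 * k + 1) + 5\<close> both nets give the accuracy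
    \<open>1 / (2 * \<nu> (2 * k + 1) + 2)\<close>.\<close>

lemma phase:
  assumes lam: "0 < lam" and K: "6 * \<nu> (2 * k + 1) + 5 \<le> K"
  defines "lh \<equiv> lam_hat b \<gamma> \<iota> \<nu> lam k" and "q \<equiv> p_seq b D \<gamma> \<iota> \<nu> lam k"
  shows "\<exists>m \<le> Psi f h b0 b D \<gamma> \<iota> lh K g q. \<exists>U\<in>sets M. prob U \<le> lh \<and>
    (\<forall>\<omega>\<in>space M - U. (\<forall>n. dist (x n \<omega>) pt \<le> real (b (lam / 3))) \<longrightarrow>
      (\<forall>z\<in>AF (Z_tilde f h b0 \<mu> \<zeta> b D \<gamma> \<iota> lh K g q). \<forall>i\<in>{m..m + g m}. \<forall>i'\<in>{m..m + g m}.
        \<bar>G (dist (x i \<omega>) z) - G (dist (x i' \<omega>) z)\<bar> \<le> 1 / (2 * real (\<nu> (2 * k + 1)) + 2)))"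
proof -
  let ?\<nu> = "\<nu> (2 * k + 1)"
  define B1 where "B1 = real (b (lh / 2)) + D"
  define B2 where "B2 = max (2 * real (b (lam / 3))) (real (b (lam / 3)) + D)"
  define q1 where "q1 = \<gamma> (\<iota> B1 (3 * K + 2))"
  define \<epsilon> where "\<epsilon> = eps_of (3 * K + 2)"
  define ls where "ls = lam_star b D \<gamma> \<iota> lh K"
  define A where "A = AF (Z_tilde f h b0 \<mu> \<zeta> b D \<gamma> \<iota> lh K g q)"
  have q: "q = \<gamma> (\<iota> B2 (6 * ?\<nu> + 5))" by (simp add: q_def p_seq_def B2_def)
  have q0: "0 < q" "0 < q1" by (auto simp: q q1_def \<gamma>_pos)
  have lh: "0 < lh" using lam by (simp add: lh_def lam_hat_def)
  have ls: "ls = lh / (2 * real q1)" by (simp add: ls_def lam_star_def q1_def B1_def)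
  have ls0: "0 < ls" using lh q0 by (simp add: ls)
  have \<epsilon>: "0 < \<epsilon>" "\<epsilon> \<le> 1" "\<epsilon> = 1 / (3 * real K + 3)" by (auto simp: \<epsilon>_def eps_of_def)
  have K': "6 * real ?\<nu> + 5 \<le> real K" using K by linarith
  have AX: "A \<subseteq> X0" using AF_X0 by (simp add: A_def)
  have interval: "\<exists>m \<le> Psi f h b0 b D \<gamma> \<iota> lh K g q. \<forall>z\<in>S. prob (oscillation \<epsilon> m (m + g m) z) < ls"
    if "finite S" "card S \<le> q" "S \<subseteq> A" for S
    using that q0(1) ls0 \<epsilon>
    by (intro stable_interval) (auto simp: Psi_def Z_tilde_def A_def ls_def \<epsilon>_def)
  have union: "prob (\<Union>z\<in>S. oscillation \<epsilon> m m' z) \<le> lh / 2"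
    if "finite S" "card S \<le> q1" "\<forall>z\<in>S. prob (oscillation \<epsilon> m m' z) < ls" for S m m'
  proof -
    have "prob (\<Union>z\<in>S. oscillation \<epsilon> m m' z) \<le> (\<Sum>z\<in>S. prob (oscillation \<epsilon> m m' z))"
      using that by (intro finite_measure_subadditive_finite) (auto intro: oscillation_sets)
    also have "\<dots> \<le> (\<Sum>z\<in>S. ls)" using that by (intro sum_mono) (auto intro: less_imp_le)
    also have "\<dots> = real (card S) * ls" by simp
    also have "\<dots> \<le> real q1 * ls" using that ls0 by (intro mult_right_mono) auto
    also have "\<dots> = lh / 2" using q0 by (simp add: ls)
    finally show ?thesis .
  qed
  show ?thesis
  proof (cases "q1 \<le> q")
    case True
    obtain S where S: "finite S" "S \<subseteq> A" "card S \<le> q1"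
      "\<And>z. z \<in> A \<Longrightarrow> \<exists>s\<in>S. dist z s \<le> 1 / (real (\<iota> B1 (3 * K + 2)) + 1)"
      using finite_net[OF X0_tb AX, of "\<iota> B1 (3 * K + 2)"] unfolding q1_def by blast
    obtain m where m: "m \<le> Psi f h b0 b D \<gamma> \<iota> lh K g q" "\<forall>z\<in>S. prob (oscillation \<epsilon> m (m + g m) z) < ls"
      using interval[OF S(1) _ S(2)] S(3) True by auto
    \<comment> \<open>This net serves the paths in the ball of radius \<open>b (lh / 2)\<close>; leaving that ball uses up the other
      half of \<open>lh\<close>.\<close>
    define V where "V = {\<omega> \<in> space M. \<exists>n. dist (x n \<omega>) pt > real (b (lh / 2))}"
    define U where "U = V \<union> (\<Union>z\<in>S. oscillation \<epsilon> m (m + g m) z)"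
    have [measurable]: "V \<in> sets M" "(\<Union>z\<in>S. oscillation \<epsilon> m (m + g m) z) \<in> sets M"
    proof -
      note dist_meas[measurable]
      show "V \<in> sets M" unfolding V_def by measurable
      show "(\<Union>z\<in>S. oscillation \<epsilon> m (m + g m) z) \<in> sets M"
        using S(1) oscillation_sets by auto
    qed
    have "prob U \<le> prob V + prob (\<Union>z\<in>S. oscillation \<epsilon> m (m + g m) z)"
      unfolding U_def by (rule measure_Un_le) measurable
    also have "\<dots> \<le> lh / 2 + lh / 2"
      using bounded[of "lh / 2"] lh union[OF S(1,3) m(2)] by (intro add_mono) (auto simp: V_def)
    finally have pU: "prob U \<le> lh" by simp
    have "U \<in> sets M" unfolding U_def by measurable
    moreover have "\<bar>G (dist (x i \<omega>) z) - G (dist (x i' \<omega>) z)\<bar> \<le> 1 / (2 * real ?\<nu> + 2)"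
      if \<omega>: "\<omega> \<in> space M - U" and z: "z \<in> A" and i: "i \<in> {m..m + g m}" "i' \<in> {m..m + g m}" for \<omega> z i i'
    proof -
      obtain s where s: "s \<in> S" "dist z s \<le> 1 / (real (\<iota> B1 (3 * K + 2)) + 1)" using S(4)[OF z] by blast
      have "\<bar>G (dist (x i \<omega>) z) - G (dist (x i' \<omega>) z)\<bar> \<le> \<epsilon> + 2 / (real (3 * K + 2) + 1)"
      proof (rule oscillation_net[OF _ _ _ _ s(2) _ i])
        show "dist (x n \<omega>) pt + D \<le> B1" for n
          using \<omega> by (auto simp: U_def V_def B1_def not_less)
        show "\<omega> \<notin> oscillation \<epsilon> m (m + g m) s" using \<omega> s by (auto simp: U_def)
      qed (use \<omega> z s S AX in auto)
      also have "\<dots> = 1 / (real K + 1)" by (simp add: \<epsilon>(3) field_simps)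
      also have "\<dots> \<le> 1 / (2 * real ?\<nu> + 2)" using K' by (intro frac_le) auto
      finally show ?thesis .
    qed
    ultimately show ?thesis using m(1) pU unfolding A_def by blast
  next
    case False
    obtain S where S: "finite S" "S \<subseteq> A" "card S \<le> q"
      "\<And>z. z \<in> A \<Longrightarrow> \<exists>s\<in>S. dist z s \<le> 1 / (real (\<iota> B2 (6 * ?\<nu> + 5)) + 1)"
      using finite_net[OF X0_tb AX, of "\<iota> B2 (6 * ?\<nu> + 5)"] unfolding q by blast
    obtain m where m: "m \<le> Psi f h b0 b D \<gamma> \<iota> lh K g q" "\<forall>z\<in>S. prob (oscillation \<epsilon> m (m + g m) z) < ls"
      using interval[OF S(1) S(3) S(2)] by auto
    define U where "U = (\<Union>z\<in>S. oscillation \<epsilon> m (m + g m) z)"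
    have pU: "prob U \<le> lh" using union[OF S(1) _ m(2)] S(3) False lh by (simp add: U_def)
    have "U \<in> sets M" using S(1) oscillation_sets by (auto simp: U_def)
    moreover have "\<bar>G (dist (x i \<omega>) z) - G (dist (x i' \<omega>) z)\<bar> \<le> 1 / (2 * real ?\<nu> + 2)"
      if \<omega>: "\<omega> \<in> space M - U" and bd: "\<forall>n. dist (x n \<omega>) pt \<le> real (b (lam / 3))"
        and z: "z \<in> A" and i: "i \<in> {m..m + g m}" "i' \<in> {m..m + g m}" for \<omega> z i i'
    proof -
      obtain s where s: "s \<in> S" "dist z s \<le> 1 / (real (\<iota> B2 (6 * ?\<nu> + 5)) + 1)" using S(4)[OF z] by blast
      have "\<bar>G (dist (x i \<omega>) z) - G (dist (x i' \<omega>) z)\<bar> \<le> \<epsilon> + 2 / (real (6 * ?\<nu> + 5) + 1)"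
      proof (rule oscillation_net[OF _ _ _ _ s(2) _ i])
        show "dist (x n \<omega>) pt + D \<le> B2" for n
          using bd[rule_format, of n] by (simp add: B2_def)
        show "\<omega> \<notin> oscillation \<epsilon> m (m + g m) s" using \<omega> s by (auto simp: U_def)
      qed (use \<omega> z s S AX in auto)
      also have "\<dots> \<le> 1 / (6 * real ?\<nu> + 6) + 2 / (6 * real ?\<nu> + 6)"
      proof -
        have "1 / (3 * real K + 3) \<le> 1 / (6 * real ?\<nu> + 6)" using K' by (intro frac_le) auto
        moreover have "real (6 * ?\<nu> + 5) + 1 = 6 * real ?\<nu> + 6" by simp
        ultimately show ?thesis unfolding \<epsilon>(3) by (simp only: add_le_cancel_right)
      qed
      also have "\<dots> = 1 / (2 * real ?\<nu> + 2)" by (simp add: field_simps)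
      finally show ?thesis .
    qed
    ultimately show ?thesis using m(1) pU unfolding A_def by blast
  qed
qed

end


section \<open>From metastability to almost sure convergence\<close>

text \<open>If the paths that oscillate by more than \<open>1/(k+1)\<close> beyond every \<open>n\<close> had positive outer measure, a
    function \<open>g\<close> contradicting metastability could be built by recursion: outer measure is continuous
    along increasing sequences of arbitrary sets, so the windows \<open>[n; n + g n]\<close> can be chosen one after
    another so large that the set of paths oscillating in all windows so far keeps an outer measure
    above a fixed bound.\<close>

lemma (in prob_space) metastable_imp_AE_Cauchy:
  fixes x :: "nat \<Rightarrow> 'a \<Rightarrow> 'x::metric_space"
  assumes meta: "\<And>lam k g. lam > 0 \<Longrightarrow> \<exists>\<Delta>. outer_measure_of M {\<omega> \<in> space M. \<forall>n\<le>\<Delta>.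
      \<exists>i\<in>{n..n + g n}. \<exists>j\<in>{n..n + g n}. dist (x i \<omega>) (x j \<omega>) > 1 / (real k + 1)} < ennreal lam"
  shows "AE \<omega> in M. Cauchy (\<lambda>n. x n \<omega>)"
proof -
  define NC where "NC k = {\<omega> \<in> space M. \<forall>n. \<exists>i\<ge>n. \<exists>j\<ge>n. dist (x i \<omega>) (x j \<omega>) > 1 / (real k + 1)}" for k
  have null: "outer_measure_of M (NC k) = 0" for k
  proof (rule ccontr)
    assume "outer_measure_of M (NC k) \<noteq> 0"
    then have "0 < outer_measure_of M (NC k)" by (simp add: zero_less_iff_neq_zero)
    then obtain l where l: "0 < l" "l < outer_measure_of M (NC k)" using dense by blast
    then have "l < \<infinity>" using top.extremum_strict less_top by fastforce
    then obtain lam where lam: "l = ennreal lam" "0 < lam"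
      using l(1) by (cases l) (auto simp: ennreal_zero_less_top)
    define E where "E n m = {\<omega> \<in> space M. \<exists>i\<in>{n..n + m}. \<exists>j\<in>{n..n + m}.
        dist (x i \<omega>) (x j \<omega>) > 1 / (real k + 1)}" for n m
    have ext: "\<exists>m. l < outer_measure_of M (C \<inter> E n m)"
      if C: "C \<subseteq> NC k" "l < outer_measure_of M C" for C n
    proof -
      have "C = (\<Union>m. C \<inter> E n m)"
      proof (intro equalityI subsetI)
        fix \<omega> assume \<omega>: "\<omega> \<in> C"
        then obtain i j where ij: "i \<ge> n" "j \<ge> n" "dist (x i \<omega>) (x j \<omega>) > 1 / (real k + 1)" "\<omega> \<in> space M"
          using C(1) unfolding NC_def by blast
        then have "i \<in> {n..n + max i j}" "j \<in> {n..n + max i j}" by auto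
        then have "\<omega> \<in> E n (max i j)" unfolding E_def using ij by blast
        then show "\<omega> \<in> (\<Union>m. C \<inter> E n m)" using \<omega> by auto
      qed auto
      moreover have "(SUP m. outer_measure_of M (C \<inter> E n m)) = outer_measure_of M (\<Union>m. C \<inter> E n m)"
      proof (rule SUP_outer_measure_of_incseq)
        show "C \<inter> E n m \<subseteq> space M" for m by (auto simp: E_def)
        show "incseq (\<lambda>m. C \<inter> E n m)"
        proof (rule incseq_SucI)
          fix m
          have "{n..n + m} \<subseteq> {n..n + Suc m}" by auto
          then show "C \<inter> E n m \<subseteq> C \<inter> E n (Suc m)" unfolding E_def by blast
        qed
      qed
      ultimately have "l < (SUP m. outer_measure_of M (C \<inter> E n m))" using C(2) by metis
      then show ?thesis by (simp add: less_SUP_iff)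
    qed
    define C where "C = rec_nat (NC k) (\<lambda>n C. C \<inter> E n (SOME m. l < outer_measure_of M (C \<inter> E n m)))"
    define g where "g n = (SOME m. l < outer_measure_of M (C n \<inter> E n m))" for n
    have C: "C 0 = NC k" "C (Suc n) = C n \<inter> E n (g n)" for n by (simp_all add: C_def g_def)
    have inv: "C n \<subseteq> NC k \<and> l < outer_measure_of M (C n)" for n
    proof (induction n)
      case 0
      then show ?case using l by (simp add: C)
    next
      case (Suc n)
      have "l < outer_measure_of M (C n \<inter> E n (g n))"
        unfolding g_def using Suc by (intro someI_ex[OF ext]) auto
      then show ?case using Suc by (auto simp: C)
    qed
    have sub: "C (Suc n) \<subseteq> {\<omega> \<in> space M. \<forall>i\<le>n. \<omega> \<in> E i (g i)}" for n
    proof (induction n)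
      case 0
      then show ?case by (auto simp: C E_def)
    next
      case (Suc n)
      then show ?case by (auto simp: C(2)[of "Suc n"] le_Suc_eq)
    qed
    obtain \<Delta> where \<Delta>: "outer_measure_of M {\<omega> \<in> space M. \<forall>n\<le>\<Delta>.
      \<exists>i\<in>{n..n + g n}. \<exists>j\<in>{n..n + g n}. dist (x i \<omega>) (x j \<omega>) > 1 / (real k + 1)} < ennreal lam"
      using meta[OF lam(2)] by blast
    have "{\<omega> \<in> space M. \<forall>i\<le>\<Delta>. \<omega> \<in> E i (g i)} \<subseteq> {\<omega> \<in> space M. \<forall>n\<le>\<Delta>.
      \<exists>i\<in>{n..n + g n}. \<exists>j\<in>{n..n + g n}. dist (x i \<omega>) (x j \<omega>) > 1 / (real k + 1)}"
      by (auto simp: E_def)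
    with sub[of \<Delta>] have "outer_measure_of M (C (Suc \<Delta>)) \<le> outer_measure_of M {\<omega> \<in> space M. \<forall>n\<le>\<Delta>.
      \<exists>i\<in>{n..n + g n}. \<exists>j\<in>{n..n + g n}. dist (x i \<omega>) (x j \<omega>) > 1 / (real k + 1)}"
      by (intro outer_measure_of_mono) (rule subset_trans)
    then have "l < ennreal lam" using inv[of "Suc \<Delta>"] \<Delta> by (meson less_le_trans less_trans)
    then show False using lam by simp
  qed
  have "AE \<omega> in M. \<omega> \<notin> NC k" for k
  proof -
    have "NC k \<subseteq> space M" by (auto simp: NC_def)
    then obtain E where "E \<in> sets M" "NC k \<subseteq> E" "outer_measure_of M (NC k) = emeasure M E"
      using outer_measure_of_attain by metis
    then have "E \<in> null_sets M" using null[of k] by auto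
    then show ?thesis by (rule AE_I') (use \<open>NC k \<subseteq> E\<close> in auto)
  qed
  then have "AE \<omega> in M. \<forall>k. \<omega> \<notin> NC k" by (simp add: AE_all_countable)
  then show ?thesis
    using AE_space
  proof eventually_elim
    case (elim \<omega>)
    show ?case
    proof (rule metric_CauchyI)
      fix e :: real assume "0 < e"
      then obtain k where "inverse (real (Suc k)) < e" using reals_Archimedean by blast
      then have k: "1 / (real k + 1) < e" by (simp add: inverse_eq_divide add.commute)
      have "\<omega> \<notin> NC k" using elim by simp
      then obtain n where "\<forall>i\<ge>n. \<forall>j\<ge>n. \<not> dist (x i \<omega>) (x j \<omega>) > 1 / (real k + 1)"
        using elim(2) by (auto simp: NC_def)
      then have "\<forall>i\<ge>n. \<forall>j\<ge>n. dist (x i \<omega>) (x j \<omega>) < e"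
        using k by (meson le_less_trans not_less)
      then show "\<exists>n. \<forall>i\<ge>n. \<forall>j\<ge>n. dist (x i \<omega>) (x j \<omega>) < e" by blast
    qed
  qed
qed

section \<open>The rate of metastability\<close>

text \<open>The summation over pairs matters: different phases may have the same index \<open>k\<close> and the same starting
    point \<open>N\<close>, but such a pair contributes its event only once.\<close>

lemma sum_half_powers_le:
  assumes "finite (P :: (nat \<times> nat) set)"
  shows "(\<Sum>(k, N)\<in>P. 1 / 2 ^ (k + N + 2)) \<le> (1 :: real)"
proof -
  have g: "(\<Sum>i<n. 1 / 2 ^ Suc i) = 1 - 1 / (2 ^ n :: real)" for n
    by (induction n) (auto simp: field_simps)
  then have g1: "(\<Sum>i<n. 1 / 2 ^ Suc i) \<le> (1 :: real)" for n by simp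
  obtain A where "fst ` P \<subseteq> {..<A}" using assms by (meson finite_imageI finite_nat_iff_bounded)
  moreover obtain B where "snd ` P \<subseteq> {..<B}" using assms by (meson finite_imageI finite_nat_iff_bounded)
  ultimately have "P \<subseteq> {..<A} \<times> {..<B}" by force
  then have "(\<Sum>(k, N)\<in>P. 1 / 2 ^ (k + N + 2)) \<le> (\<Sum>(k, N)\<in>{..<A} \<times> {..<B}. 1 / 2 ^ (k + N + 2) :: real)"
    by (intro sum_mono2) auto
  also have "\<dots> = (\<Sum>k<A. 1 / 2 ^ Suc k) * (\<Sum>N<B. 1 / 2 ^ Suc N)"
    by (simp add: sum.cartesian_product[symmetric] sum_product power_add)
  also have "\<dots> \<le> 1 * 1" using g1 by (intro mult_mono) (auto intro: sum_nonneg)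
  finally show ?thesis by simp
qed

context quasi_fejer
begin

definition misses :: "real \<Rightarrow> nat \<Rightarrow> nat \<Rightarrow> 'w set" where
  "misses lam k N = {\<omega> \<in> space M. \<forall>n\<in>{N..Phi' \<Phi> lam k N}. x n \<omega> \<notin> AF k}"

lemma misses_sets: "misses lam k N \<in> sets M"
proof -
  have [measurable]: "{\<omega> \<in> space M. x n \<omega> \<notin> AF k} \<in> sets M" for n k
  proof -
    have "{\<omega> \<in> space M. x n \<omega> \<notin> AF k} = x n -` (- AF k) \<inter> space M" by auto
    moreover have "- AF k \<in> sets borel" using AF_borel by (simp add: borel_comp)
    ultimately show ?thesis using measurable_sets[OF x_meas(2)] by metis
  qed
  show ?thesis unfolding misses_def by (intro sets.sets_Collect_finite_All) auto
qed

lemma prob_misses_less: "0 < lam \<Longrightarrow> prob (misses lam k N) < lam / 2 ^ (k + N + 2)"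
  unfolding misses_def Phi'_def by (intro approx) simp

text \<open>For each phase \<open>i \<le> P\<close>, the lemma \<open>phase\<close> yields a starting point \<open>m i\<close> from which
    \<open>G (dist (x n \<omega>) z)\<close> is stable for all points \<open>z\<close> of a late approximant, on an interval long enough
    to contain a time \<open>t i\<close> with \<open>x (t i) \<omega>\<close> in \<open>AF (K i)\<close> together with the window \<open>[t i; t i + g (t i)]\<close>.
    By total boundedness two of these \<open>P + 1\<close> visited points are close, say for \<open>i < j\<close>. The indices
    \<open>K\<close> are arranged so that \<open>z = x (t j) \<omega>\<close> belongs to the approximant used in phase \<open>i\<close>. As
    \<open>G (dist (x n \<omega>) z)\<close> is small at \<open>n = t i\<close> and stable, it is small on the whole window, and
    inverse continuity bounds all distances to \<open>z\<close> there. The three sources of failure, an unbounded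
    path, an unstable phase and a phase without visit, have probability at most \<open>lam / 3\<close> each.\<close>

lemma metastability:
  assumes lam: "0 < lam"
  shows "outer_measure_of M {\<omega> \<in> space M.
         \<forall>n \<le> Delta f h b0 \<mu> \<zeta> \<Phi> b D \<gamma> \<iota> \<nu> lam k g.
           \<exists>i\<in>{n..n + g n}. \<exists>j\<in>{n..n + g n}. dist (x i \<omega>) (x j \<omega>) > 1 / (real k + 1)}
       < ennreal lam"
proof -
  let ?\<nu> = "\<nu> (2 * k + 1)"
  define P where "P = net_index b \<gamma> \<iota> \<nu> lam k"
  define lh where "lh = lam_hat b \<gamma> \<iota> \<nu> lam k"
  define q where "q = p_seq b D \<gamma> \<iota> \<nu> lam k"
  define K where "K i = k_seq f h b0 \<mu> \<zeta> \<Phi> b D \<gamma> \<iota> \<nu> lam k g i" for i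
  define H where "H i = h_fun \<Phi> g (lam / 3) (K i)" for i
  define Zt where "Zt i = Z_tilde f h b0 \<mu> \<zeta> b D \<gamma> \<iota> lh (K i) (H i) q" for i
  define Ps where "Ps i = Psi f h b0 b D \<gamma> \<iota> lh (K i) (H i) q" for i
  define \<beta> where "\<beta> = real (b (lam / 3))"
  have K_Suc: "K (Suc j) = Max ((\<lambda>i. max (Zt i) (K i)) ` {..j})" for j
    by (simp add: K_def Zt_def H_def lh_def q_def)
  have K_ge: "Zt i \<le> K j" "K i \<le> K j" if ij: "i < j" for i j
  proof -
    obtain j' where j': "j = Suc j'" using ij by (cases j) auto
    have "max (Zt i) (K i) \<le> K j"
      unfolding j' K_Suc using ij j' by (intro Max_ge) auto
    then show "Zt i \<le> K j" "K i \<le> K j" by auto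
  qed
  have K_0: "6 * ?\<nu> + 5 \<le> K i" for i
  proof (cases i)
    case 0
    then show ?thesis by (simp add: K_def)
  next
    case (Suc j)
    have "6 * ?\<nu> + 5 \<le> K 0" by (simp add: K_def)
    then show ?thesis using K_ge(2)[of 0 i] Suc by simp
  qed
  define stable where "stable i m U \<longleftrightarrow> (\<forall>\<omega>\<in>space M - U. (\<forall>n. dist (x n \<omega>) pt \<le> \<beta>) \<longrightarrow>
      (\<forall>z\<in>AF (Zt i). \<forall>j\<in>{m..m + H i m}. \<forall>j'\<in>{m..m + H i m}.
        \<bar>G (dist (x j \<omega>) z) - G (dist (x j' \<omega>) z)\<bar> \<le> 1 / (2 * real ?\<nu> + 2)))" for i m U
  have "\<exists>m\<le>Ps i. \<exists>U\<in>sets M. prob U \<le> lh \<and> stable i m U" for i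
    unfolding stable_def Ps_def Zt_def lh_def q_def \<beta>_def by (rule phase[OF lam K_0])
  then obtain m U where m: "\<And>i. m i \<le> Ps i" and U: "\<And>i. U i \<in> sets M" "\<And>i. prob (U i) \<le> lh"
    and stable: "\<And>i. stable i (m i) (U i)"
    by metis
  define V where "V = {\<omega> \<in> space M. \<exists>n. dist (x n \<omega>) pt > \<beta>}"
  define Pr where "Pr = (\<lambda>i. (K i, m i)) ` {..P}"
  define B where "B = V \<union> (\<Union>i\<le>P. U i) \<union> (\<Union>(k', N)\<in>Pr. misses (lam / 3) k' N)"
  have Vs: "V \<in> sets M"
  proof -
    note dist_meas[measurable]
    show ?thesis unfolding V_def by measurable
  qed
  have fin: "finite Pr" by (simp add: Pr_def)
  have Us: "(\<Union>i\<le>P. U i) \<in> sets M" using U(1) by auto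
  have Ms: "(\<Union>(k', N)\<in>Pr. misses (lam / 3) k' N) \<in> sets M" using fin misses_sets by auto
  have Bs: "B \<in> sets M" using Vs Us Ms by (simp add: B_def)
  have pB: "prob B < lam"
  proof -
    have "prob B \<le> prob V + prob (\<Union>i\<le>P. U i) + prob (\<Union>(k', N)\<in>Pr. misses (lam / 3) k' N)"
      unfolding B_def using Vs Us Ms
      by (intro order.trans[OF measure_Un_le] add_right_mono measure_Un_le) auto
    moreover have "prob V < lam / 3" using bounded[of "lam / 3"] lam by (simp add: V_def \<beta>_def)
    moreover have "prob (\<Union>i\<le>P. U i) \<le> lam / 3"
    proof -
      have "prob (\<Union>i\<le>P. U i) \<le> (\<Sum>i\<le>P. prob (U i))"
        using U(1) by (intro finite_measure_subadditive_finite) auto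
      also have "\<dots> \<le> (\<Sum>i\<le>P. lh)" using U(2) by (intro sum_mono)
      also have "\<dots> = lam / 3" by (simp add: lh_def lam_hat_def P_def field_simps)
      finally show ?thesis .
    qed
    moreover have "prob (\<Union>(k', N)\<in>Pr. misses (lam / 3) k' N) \<le> lam / 3"
    proof -
      have "prob (\<Union>p\<in>Pr. misses (lam / 3) (fst p) (snd p))
          \<le> (\<Sum>p\<in>Pr. prob (misses (lam / 3) (fst p) (snd p)))"
        using misses_sets fin by (intro finite_measure_subadditive_finite) auto
      also have "\<dots> \<le> (\<Sum>p\<in>Pr. lam / 3 / 2 ^ (fst p + snd p + 2))"
        using lam by (intro sum_mono less_imp_le prob_misses_less) simp
      also have "\<dots> = lam / 3 * (\<Sum>p\<in>Pr. 1 / 2 ^ (fst p + snd p + 2))"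
        by (simp add: sum_distrib_left)
      also have "\<dots> \<le> lam / 3 * 1"
        using sum_half_powers_le[OF fin] lam by (intro mult_left_mono) (auto simp: case_prod_beta)
      finally show ?thesis by (simp add: case_prod_beta)
    qed
    ultimately show ?thesis by linarith
  qed
  have Dl: "Phi' \<Phi> (lam / 3) (K i) n \<le> Delta f h b0 \<mu> \<zeta> \<Phi> b D \<gamma> \<iota> \<nu> lam k g" if "i \<le> P" "n \<le> Ps i" for i n
  proof -
    let ?D = "Delta_i f h b0 \<mu> \<zeta> \<Phi> b D \<gamma> \<iota> \<nu> lam k g"
    have "Phi' \<Phi> (lam / 3) (K i) n \<le> ?D i"
      unfolding Delta_i_def K_def[symmetric] H_def[symmetric] lh_def[symmetric] q_def[symmetric] Ps_def[symmetric]
      using that by (intro Max_ge) (auto simp: setcompr_eq_image)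
    also have "\<dots> \<le> Delta f h b0 \<mu> \<zeta> \<Phi> b D \<gamma> \<iota> \<nu> lam k g"
      unfolding Delta_def P_def[symmetric] using that by (intro Max_ge) (auto simp: setcompr_eq_image)
    finally show ?thesis .
  qed
  have sub: "{\<omega> \<in> space M. \<forall>n \<le> Delta f h b0 \<mu> \<zeta> \<Phi> b D \<gamma> \<iota> \<nu> lam k g.
           \<exists>i\<in>{n..n + g n}. \<exists>j\<in>{n..n + g n}. dist (x i \<omega>) (x j \<omega>) > 1 / (real k + 1)} \<subseteq> B"
  proof (rule subsetI, rule ccontr)
    fix \<omega>
    assume bad: "\<omega> \<in> {\<omega> \<in> space M. \<forall>n \<le> Delta f h b0 \<mu> \<zeta> \<Phi> b D \<gamma> \<iota> \<nu> lam k g.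
           \<exists>i\<in>{n..n + g n}. \<exists>j\<in>{n..n + g n}. dist (x i \<omega>) (x j \<omega>) > 1 / (real k + 1)}"
      and good: "\<omega> \<notin> B"
    then have \<omega>: "\<omega> \<in> space M" by simp
    have bd: "dist (x n \<omega>) pt \<le> \<beta>" for n using good \<omega> by (auto simp: B_def V_def not_less)
    have "\<exists>n. n \<in> {m i..Phi' \<Phi> (lam / 3) (K i) (m i)} \<and> x n \<omega> \<in> AF (K i)" if "i \<le> P" for i
    proof -
      have "(K i, m i) \<in> Pr" using that by (auto simp: Pr_def)
      then have "\<omega> \<notin> misses (lam / 3) (K i) (m i)" using good by (auto simp: B_def)
      then show ?thesis using \<omega> by (auto simp: misses_def)
    qed
    then obtain t where t: "\<And>i. i \<le> P \<Longrightarrow> t i \<in> {m i..Phi' \<Phi> (lam / 3) (K i) (m i)}"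
      "\<And>i. i \<le> P \<Longrightarrow> x (t i) \<omega> \<in> AF (K i)" by metis
    define y where "y i = x (t (min i P)) \<omega>" for i
    have "y i \<in> X0" for i using t(2)[of "min i P"] AF_X0 by (auto simp: y_def)
    then have "range y \<subseteq> X0" by auto
    then obtain i j where ij: "i < j" "j \<le> P"
      and cl: "dist (y i) (y j) \<le> 1 / (real (\<iota> (2 * \<beta>) (2 * ?\<nu> + 1)) + 1)"
      using X0_tb unfolding total_boundedness_modulus_def P_def net_index_def \<beta>_def by blast
    define z where "z = x (t j) \<omega>"
    have yi: "y i = x (t i) \<omega>" "y j = z" using ij by (auto simp: y_def z_def min_def)
    have zA: "z \<in> AF (Zt i)"
      using t(2)[of j] ij AF_antimono[OF K_ge(1)[OF ij(1)]] by (auto simp: z_def)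
    have G0: "G (dist (x (t i) \<omega>) z) \<le> 1 / (2 * real ?\<nu> + 2)"
    proof -
      have "dist (x (t i) \<omega>) z \<le> dist (x (t i) \<omega>) pt + dist z pt" by (rule dist_triangle2)
      then have "dist (x (t i) \<omega>) z \<le> 2 * \<beta>" using bd[of "t i"] bd[of "t j"] by (simp add: z_def)
      then have "\<bar>G (dist (x (t i) \<omega>) z) - G 0\<bar> \<le> 1 / (real (2 * ?\<nu> + 1) + 1)"
        using cl yi by (intro G_uniform_le[where c = "2 * \<beta>"]) (simp_all add: \<beta>_def)
      also have "real (2 * ?\<nu> + 1) + 1 = 2 * real ?\<nu> + 2" by simp
      finally show ?thesis by (simp add: G_0)
    qed
    have iP: "i \<le> P" using ij by simp
    have cover: "{t i..t i + g (t i)} \<subseteq> {m i..m i + H i (m i)}"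
    proof -
      let ?S = "{n + g n | n. n \<in> {m i..Phi' \<Phi> (lam / 3) (K i) (m i)}}"
      have "{m i..Phi' \<Phi> (lam / 3) (K i) (m i)} \<noteq> {}" using t(1)[OF iP] by auto
      then have "H i (m i) = Max ?S - m i" by (simp add: H_def h_fun_def)
      moreover have "t i + g (t i) \<le> Max ?S"
        using t(1)[OF iP] by (intro Max_ge) (auto simp: setcompr_eq_image)
      ultimately show ?thesis using t(1)[OF iP] by auto
    qed
    have near: "dist (x n \<omega>) z \<le> 1 / (2 * real k + 2)" if n: "n \<in> {t i..t i + g (t i)}" for n
    proof -
      have "\<bar>G (dist (x n \<omega>) z) - G (dist (x (t i) \<omega>) z)\<bar> \<le> 1 / (2 * real ?\<nu> + 2)"
      proof -
        have "\<omega> \<in> space M - U i" using good iP \<omega> by (auto simp: B_def)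
        moreover have "n \<in> {m i..m i + H i (m i)}" "t i \<in> {m i..m i + H i (m i)}" using cover n by auto
        ultimately show ?thesis using stable[of i] bd zA unfolding stable_def by blast
      qed
      then have "G (dist (x n \<omega>) z) \<le> 1 / (2 * real ?\<nu> + 2) + 1 / (2 * real ?\<nu> + 2)" using G0 by linarith
      also have "\<dots> = 1 / (real ?\<nu> + 1)" by (simp add: field_simps)
      finally have "dist (x n \<omega>) z \<le> 1 / (real (2 * k + 1) + 1)"
        using G_inverse unfolding inverse_continuity_modulus_def by (meson zero_le_dist)
      then show ?thesis by (simp add: algebra_simps)
    qed
    have "t i \<le> Phi' \<Phi> (lam / 3) (K i) (m i)" using t(1)[OF iP] by simp
    also have "\<dots> \<le> Delta f h b0 \<mu> \<zeta> \<Phi> b D \<gamma> \<iota> \<nu> lam k g" by (rule Dl[OF iP m])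
    finally obtain n n' where n: "n \<in> {t i..t i + g (t i)}" "n' \<in> {t i..t i + g (t i)}"
      "dist (x n \<omega>) (x n' \<omega>) > 1 / (real k + 1)" using bad by blast
    have "dist (x n \<omega>) (x n' \<omega>) \<le> dist (x n \<omega>) z + dist (x n' \<omega>) z" by (rule dist_triangle2)
    also have "\<dots> \<le> 1 / (2 * real k + 2) + 1 / (2 * real k + 2)" using n by (intro add_mono near)
    also have "\<dots> = 1 / (real k + 1)" by (simp add: field_simps)
    finally show False using n(3) by simp
  qed
  have "outer_measure_of M {\<omega> \<in> space M. \<forall>n \<le> Delta f h b0 \<mu> \<zeta> \<Phi> b D \<gamma> \<iota> \<nu> lam k g.
           \<exists>i\<in>{n..n + g n}. \<exists>j\<in>{n..n + g n}. dist (x i \<omega>) (x j \<omega>) > 1 / (real k + 1)}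
      \<le> outer_measure_of M B" by (rule outer_measure_of_mono[OF sub])
  also have "\<dots> = ennreal (prob B)" using Bs by (simp add: emeasure_eq_measure)
  also have "\<dots> < ennreal lam" using pB lam by (simp add: ennreal_less_iff)
  finally show ?thesis .
qed

end

theorem theorem4p18:
  fixes M :: "'w measure"
    and F :: "nat \<Rightarrow> 'w measure"
    and pt :: "'x::metric_space"
    and X0 :: "'x set"
    and AF :: "nat \<Rightarrow> 'x set"
    and G :: "real \<Rightarrow> real"
    and \<iota> :: "real \<Rightarrow> nat \<Rightarrow> nat"
    and \<nu> \<gamma> :: "nat \<Rightarrow> nat"
    and D b0 :: real
    and x :: "nat \<Rightarrow> 'w \<Rightarrow> 'x"
    and eta chi :: "nat \<Rightarrow> 'w \<Rightarrow> real"
    and f h b :: "real \<Rightarrow> nat"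
    and \<zeta> \<Phi> :: "real \<Rightarrow> nat \<Rightarrow> nat \<Rightarrow> nat"
    and \<mu> :: "nat \<Rightarrow> real \<Rightarrow> real"
  assumes "prob_space M"
    and "filtration (space M) F" and "\<And>n. subalgebra M (F n)"
    and "totally_bounded X0"
    and "(\<Inter>k. AF k) \<noteq> {}"
    and "\<And>k. AF k \<in> sets borel"
    and "\<And>k. AF (Suc k) \<subseteq> AF k" and "\<And>k. AF k \<subseteq> X0"
    and "G \<in> {0..} \<rightarrow> {0..}" and "strict_mono_on {0..} G" and "continuous_on {0..} G"
    and "G 0 = 0"
    and "uniform_continuity_modulus G \<iota>"
    and "inverse_continuity_modulus G \<nu>"
    and "total_boundedness_modulus X0 \<gamma>"
    and "\<And>z. z \<in> X0 \<Longrightarrow> dist z pt \<le> D"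
    and "adapted F x"
    and "eta \<in> l1_plus M F" and "chi \<in> l1_plus M F"
    and "\<And>lam. lam > 0 \<Longrightarrow> h lam \<ge> 1"
    and "\<And>lam. lam > 0 \<Longrightarrow> \<P>(\<omega> in M. (\<Sum>i. eta i \<omega>) \<ge> real (f lam)) < lam"
    and "\<And>lam. lam > 0 \<Longrightarrow> \<P>(\<omega> in M. (\<Prod>i. 1 + chi i \<omega>) \<ge> real (h lam)) < lam"
    and "\<And>lam r n z m. lam > 0 \<Longrightarrow> z \<in> AF (\<zeta> lam r n) \<Longrightarrow> m \<le> n \<Longrightarrow>
           \<P>(\<omega> in M. real_cond_exp M (F m) (\<lambda>\<omega>. G (dist (x (m + 1) \<omega>) z)) \<omega>
                 > (1 + chi m \<omega>) * G (dist (x m \<omega>) z) + eta m \<omega> + 1 / (real r + 1)) < lam"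
    and "\<And>lam k N. lam > 0 \<Longrightarrow>
           \<P>(\<omega> in M. \<forall>n\<in>{N..\<Phi> lam k N}. x n \<omega> \<notin> AF k) < lam"
    and "\<And>lam. lam > 0 \<Longrightarrow> \<P>(\<omega> in M. \<exists>n. dist (x n \<omega>) pt > real (b lam)) < lam"
    and "integrable M (\<lambda>\<omega>. G (dist (x 0 \<omega>) pt + D))"
    and "b0 > prob_space.expectation M (\<lambda>\<omega>. G (dist (x 0 \<omega>) pt + D))"
    and "\<And>n z. z \<in> X0 \<Longrightarrow> absolute_continuity_modulus M (\<lambda>\<omega>. G (dist (x n \<omega>) z)) (\<mu> n)"
  shows "(AE \<omega> in M. Cauchy (\<lambda>n. x n \<omega>)) \<and>
    (\<forall>lam>0. \<forall>k g.
       outer_measure_of M {\<omega> \<in> space M.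
         \<forall>n \<le> Delta f h b0 \<mu> \<zeta> \<Phi> b D \<gamma> \<iota> \<nu> lam k g.
           \<exists>i\<in>{n..n + g n}. \<exists>j\<in>{n..n + g n}. dist (x i \<omega>) (x j \<omega>) > 1 / (real k + 1)}
       < ennreal lam)"
proof -
  interpret prob_space M by fact
  interpret quasi_fejer M F pt X0 AF G \<iota> \<nu> \<gamma> D b0 x eta chi f h b \<zeta> \<Phi> \<mu>
    by (intro quasi_fejer.intro filtered_prob_space.intro quasi_fejer_axioms.intro
        filtered_prob_space_axioms.intro) (fact assms)+
  show ?thesis
    using metastability metastable_imp_AE_Cauchy[of x] by blast
qed

end
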